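(* Let $M^4_r$ be a nondegenerate hypersurface of a pseudo-Riemannian space form $N^5_s(c)$ with proper mean curvature vector field, satisfying $\Delta\vec H=\lambda\vec H$ with $\lambda$ a real constant, and let $\vec\xi$ be a unit normal vector field to $M^4_r$ with $\varepsilon=\langle\vec\xi,\vec\xi\rangle=\pm1$. Suppose that $M^4_r$ has one simple principal curvature (that is, at each point the shape operator has exactly one distinct eigenvalue). Then: (i) if $\varepsilon\lambda\le0$, then $H=0$; (ii) if $\varepsilon\lambda>0$, then $H=0$ or $H^2=\frac{\varepsilon\lambda}{4}$.
   Context: Manifolds are smooth. $N^5_s(c)$ denotes a $5$-dimensional pseudo-Riemannian space form of index $s$ and constant sectional curvature $c\in\mathbb{R}$. A nondegenerate hypersurface $M^4_r$ is a $4$-dimensional manifold isometrically immersed in $N^5_s(c)$ whose induced metric is nondegenerate, of index $r$. $\nabla$ and $\widetilde\nabla$ are the Levi-Civita connections of $M^4_r$ and $N^5_s(c)$; $A$ is the shape operator, $\widetilde\nabla_X\vec\xi=-AX$. The mean curvature is $H=\frac14\varepsilon\,\mathrm{tr}A$ and $\vec H=H\vec\xi$. The Laplacian is $\Delta\vec H=-\sum_{i=1}^4\varepsilon_i(\widetilde\nabla_{e_i}\widetilde\nabla_{e_i}\vec H-\widetilde\nabla_{\nabla_{e_i}e_i}\vec H)$ for a local orthonormal frame $\{e_i\}$ of $M^4_r$ with $\langle e_i,e_i\rangle=\varepsilon_i=\pm1$. Principal curvatures are the eigenvalues of $A$ (over $\mathbb{C}$); $A$ need not be diagonalizable, since the metric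 may be indefinite. *)

theory Defs
  imports "HOL-Analysis.Analysis"
begin

section \<open>Smooth functions and smooth manifolds\<close>

text \<open>Only meaningful for open \<open>S\<close>, which is the only case used below.\<close>

primrec ck_on :: "nat \<Rightarrow> 'a::real_normed_vector set \<Rightarrow> ('a \<Rightarrow> 'b::real_normed_vector) \<Rightarrow> bool" where
  "ck_on 0 S f \<longleftrightarrow> continuous_on S f"
| "ck_on (Suc k) S f \<longleftrightarrow>
     (\<forall>x\<in>S. f differentiable (at x)) \<and> (\<forall>v. ck_on k S (\<lambda>x. frechet_derivative f (at x) v))"

definition smooth_on :: "'a::real_normed_vector set \<Rightarrow> ('a \<Rightarrow> 'b::real_normed_vector) \<Rightarrow> bool" where
  "smooth_on S f \<longleftrightarrow> (\<forall>k. ck_on k S f)"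

text \<open>A chart of an \<open>'n\<close>-dimensional manifold: its domain together with its coordinate map.\<close>

type_synonym ('p, 'n) chart = "'p set \<times> ('p \<Rightarrow> real^'n)"

definition smooth_in :: "('p, 'n::finite) chart \<Rightarrow> 'p set \<Rightarrow> ('p \<Rightarrow> 'b::real_normed_vector) \<Rightarrow> bool" where
  "smooth_in c U h \<longleftrightarrow> smooth_on (snd c ` U) (h \<circ> inv_into (fst c) (snd c))"

definition smooth_manifold :: "'p topology \<Rightarrow> ('p, 'n::finite) chart set \<Rightarrow> bool" where
  "smooth_manifold T \<A> \<longleftrightarrow>
     Hausdorff_space T \<and> second_countable T \<and> (\<Union>c\<in>\<A>. fst c) = topspace T \<and>
     (\<forall>c\<in>\<A>. openin T (fst c) \<and> open (snd c ` fst c) \<and>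
        homeomorphic_map (subtopology T (fst c)) (top_of_set (snd c ` fst c)) (snd c)) \<and>
     (\<forall>c\<in>\<A>. \<forall>d\<in>\<A>. smooth_in c (fst c \<inter> fst d) (snd d))"

text \<open>A tangent vector at \<open>p\<close> is given by its components in each chart around \<open>p\<close>, and
  \<open>chart_deriv c h p v\<close> is the derivative at \<open>p\<close> of the vector-valued function \<open>h\<close> along the tangent
  vector with components \<open>v\<close> in the chart \<open>c\<close>. Thus \<open>chart_deriv c (snd d) p v\<close> are the components
  of that vector in the chart \<open>d\<close>, and \<open>chart_deriv c (snd d \<circ> f) p v\<close> are the \<open>d\<close>-components of its
  image under the differential of \<open>f\<close> at \<open>p\<close>.\<close>

definition chart_deriv ::
    "('p, 'n::finite) chart \<Rightarrow> ('p \<Rightarrow> 'b::real_normed_vector) \<Rightarrow> 'p \<Rightarrow> real^'n \<Rightarrow> 'b" where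
  "chart_deriv c h p v = frechet_derivative (h \<circ> inv_into (fst c) (snd c)) (at (snd c p)) v"

section \<open>Pseudo-Riemannian metrics\<close>

definition bil :: "real^'n^'n \<Rightarrow> real^'n \<Rightarrow> real^'n \<Rightarrow> real" where
  "bil G u v = u \<bullet> (G *v v)"

text \<open>A field of bilinear forms is given by its Gram matrices \<open>g c p\<close> in all charts \<open>c\<close>.\<close>

type_synonym ('p, 'n) metric = "('p, 'n) chart \<Rightarrow> 'p \<Rightarrow> real^'n^'n"

definition has_index :: "real^'n^'n \<Rightarrow> nat \<Rightarrow> bool" where
  "has_index G s \<longleftrightarrow>
     (\<exists>S. subspace S \<and> (\<forall>v\<in>S. v \<noteq> 0 \<longrightarrow> bil G v v < 0) \<and> dim S = s) \<and>
     (\<forall>S. subspace S \<and> (\<forall>v\<in>S. v \<noteq> 0 \<longrightarrow> bil G v v < 0) \<longrightarrow> dim S \<le> s)"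

definition pseudo_riemannian ::
    "'p topology \<Rightarrow> ('p, 'n::finite) chart set \<Rightarrow> ('p, 'n) metric \<Rightarrow> nat \<Rightarrow> bool" where
  "pseudo_riemannian T \<A> g s \<longleftrightarrow>
     smooth_manifold T \<A> \<and>
     (\<forall>c\<in>\<A>. smooth_in c (fst c) (g c)) \<and>
     (\<forall>c\<in>\<A>. \<forall>d\<in>\<A>. \<forall>p\<in>fst c \<inter> fst d. \<forall>u v.
        bil (g c p) u v = bil (g d p) (chart_deriv c (snd d) p u) (chart_deriv c (snd d) p v)) \<and>
     (\<forall>c\<in>\<A>. \<forall>p\<in>fst c.
        (\<forall>u v. bil (g c p) u v = bil (g c p) v u) \<and>
        (\<forall>u. (\<forall>v. bil (g c p) u v = 0) \<longrightarrow> u = 0) \<and>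
        has_index (g c p) s)"

section \<open>Levi-Civita connection and curvature\<close>

text \<open>\<open>christoffel g c p u v\<close> has the \<open>c\<close>-components \<open>\<Sum>i j. \<Gamma>\<^sup>k\<^sub>i\<^sub>j u\<^sub>i v\<^sub>j\<close>. It is the Koszul formula for
  the fields whose \<open>c\<close>-components are the constants \<open>u\<close>, \<open>v\<close> and \<open>axis l 1\<close>; their brackets vanish.\<close>

definition christoffel ::
    "('p, 'n::finite) metric \<Rightarrow> ('p, 'n) chart \<Rightarrow> 'p \<Rightarrow> real^'n \<Rightarrow> real^'n \<Rightarrow> real^'n" where
  "christoffel g c p u v =
     matrix_inv (g c p) *v
       (\<chi> l. (chart_deriv c (\<lambda>q. bil (g c q) v (axis l 1)) p u
             + chart_deriv c (\<lambda>q. bil (g c q) u (axis l 1)) p v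
             - chart_deriv c (\<lambda>q. bil (g c q) u v) p (axis l 1)) / 2)"

text \<open>Covariant derivative (for the Levi-Civita connection of the target metric \<open>g\<close>) of a vector field
  along a map \<open>f\<close>, at \<open>p\<close>, in the direction with components \<open>x\<close> in the chart \<open>c\<close> of the source. Both
  the field \<open>V\<close> and the result are given by their components in the chart \<open>d\<close> of the target. For
  \<open>f = id\<close> and \<open>d = c\<close> it is the usual covariant derivative of vector fields.\<close>

definition cov_deriv ::
    "('q, 'k::finite) metric \<Rightarrow> ('p, 'n::finite) chart \<Rightarrow> ('q, 'k) chart \<Rightarrow> ('p \<Rightarrow> 'q) \<Rightarrow>
     ('p \<Rightarrow> real^'k) \<Rightarrow> 'p \<Rightarrow> real^'n \<Rightarrow> real^'k" where
  "cov_deriv g c d f V p x =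
     chart_deriv c V p x + christoffel g d (f p) (chart_deriv c (snd d \<circ> f) p x) (V p)"

text \<open>\<open>R(u,v)w = \<nabla>\<^sub>u\<nabla>\<^sub>vw - \<nabla>\<^sub>v\<nabla>\<^sub>uw - \<nabla>\<^bsub>[u,v]\<^esub>w\<close>, where \<open>u\<close>, \<open>v\<close>, \<open>w\<close> are extended with constant
  components in the chart \<open>c\<close>, so that the bracket vanishes.\<close>

definition curvature ::
    "('p, 'n::finite) metric \<Rightarrow> ('p, 'n) chart \<Rightarrow> 'p \<Rightarrow> real^'n \<Rightarrow> real^'n \<Rightarrow> real^'n \<Rightarrow> real^'n" where
  "curvature g c p u v w =
     cov_deriv g c c id (\<lambda>q. cov_deriv g c c id (\<lambda>_. w) q v) p u
     - cov_deriv g c c id (\<lambda>q. cov_deriv g c c id (\<lambda>_. w) q u) p v"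

text \<open>Sectional curvature is defined on the nondegenerate tangent planes only. Neither connectedness
  nor completeness is required of a space form here.\<close>

definition space_form ::
    "'p topology \<Rightarrow> ('p, 'n::finite) chart set \<Rightarrow> ('p, 'n) metric \<Rightarrow> nat \<Rightarrow> real \<Rightarrow> bool" where
  "space_form T \<A> g s \<kappa> \<longleftrightarrow>
     pseudo_riemannian T \<A> g s \<and>
     (\<forall>c\<in>\<A>. \<forall>p\<in>fst c. \<forall>u v.
        let Q = bil (g c p) u u * bil (g c p) v v - (bil (g c p) u v)\<^sup>2
        in Q \<noteq> 0 \<longrightarrow> bil (g c p) (curvature g c p u v v) u / Q = \<kappa>)"

section \<open>Hypersurfaces\<close>

definition isometric_immersion ::
    "'p topology \<Rightarrow> ('p, 'n::finite) chart set \<Rightarrow> ('p, 'n) metric \<Rightarrow>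
     'q topology \<Rightarrow> ('q, 'k::finite) chart set \<Rightarrow> ('q, 'k) metric \<Rightarrow> ('p \<Rightarrow> 'q) \<Rightarrow> bool" where
  "isometric_immersion T \<A> g T' \<B> g' f \<longleftrightarrow>
     continuous_map T T' f \<and>
     (\<forall>c\<in>\<A>. \<forall>d\<in>\<B>.
        smooth_in c (fst c \<inter> f -` fst d) (snd d \<circ> f) \<and>
        (\<forall>p\<in>fst c \<inter> f -` fst d.
           inj (chart_deriv c (snd d \<circ> f) p) \<and>
           (\<forall>u v. bil (g c p) u v =
              bil (g' d (f p)) (chart_deriv c (snd d \<circ> f) p u) (chart_deriv c (snd d \<circ> f) p v))))"

text \<open>\<open>\<xi> d p\<close> are the components at \<open>f p\<close> in the chart \<open>d\<close> of the ambient manifold.\<close>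

definition unit_normal_field ::
    "('p, 'n::finite) chart set \<Rightarrow> ('q, 'k::finite) chart set \<Rightarrow> ('q, 'k) metric \<Rightarrow> ('p \<Rightarrow> 'q) \<Rightarrow>
     (('q, 'k) chart \<Rightarrow> 'p \<Rightarrow> real^'k) \<Rightarrow> real \<Rightarrow> bool" where
  "unit_normal_field \<A> \<B> g' f \<xi> \<epsilon> \<longleftrightarrow>
     (\<forall>c\<in>\<A>. \<forall>d\<in>\<B>. \<forall>d'\<in>\<B>. \<forall>p\<in>fst c \<inter> f -` (fst d \<inter> fst d').
        \<xi> d' p = chart_deriv d (snd d') (f p) (\<xi> d p)) \<and>
     (\<forall>c\<in>\<A>. \<forall>d\<in>\<B>.
        smooth_in c (fst c \<inter> f -` fst d) (\<xi> d) \<and>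
        (\<forall>p\<in>fst c \<inter> f -` fst d.
           bil (g' d (f p)) (\<xi> d p) (\<xi> d p) = \<epsilon> \<and>
           (\<forall>u. bil (g' d (f p)) (\<xi> d p) (chart_deriv c (snd d \<circ> f) p u) = 0)))"

text \<open>Weingarten formula; \<open>A c p\<close> is the matrix of the shape operator at \<open>p\<close> in the chart \<open>c\<close>. As the
  differential of \<open>f\<close> is injective, \<open>A\<close> is uniquely determined by \<open>\<xi>\<close> at all points of the chart
  domains.\<close>

definition shape_operator ::
    "('p, 'n::finite) chart set \<Rightarrow> ('q, 'k::finite) chart set \<Rightarrow> ('q, 'k) metric \<Rightarrow> ('p \<Rightarrow> 'q) \<Rightarrow>
     (('q, 'k) chart \<Rightarrow> 'p \<Rightarrow> real^'k) \<Rightarrow> (('p, 'n) chart \<Rightarrow> 'p \<Rightarrow> real^'n^'n) \<Rightarrow> bool" where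
  "shape_operator \<A> \<B> g' f \<xi> A \<longleftrightarrow>
     (\<forall>c\<in>\<A>. \<forall>d\<in>\<B>. \<forall>p\<in>fst c \<inter> f -` fst d. \<forall>x.
        cov_deriv g' c d f (\<xi> d) p x = - chart_deriv c (snd d \<circ> f) p (A c p *v x))"

definition principal_curvature :: "real^'n^'n \<Rightarrow> complex \<Rightarrow> bool" where
  "principal_curvature S \<mu> \<longleftrightarrow>
     (\<exists>v::complex^'n. v \<noteq> 0 \<and> (\<chi> i j. complex_of_real (S$i$j)) *v v = \<mu> *s v)"

definition local_orthonormal_frame ::
    "'p topology \<Rightarrow> ('p, 'n::finite) metric \<Rightarrow> ('p, 'n) chart \<Rightarrow> 'p set \<Rightarrow>
     ('n \<Rightarrow> real) \<Rightarrow> ('n \<Rightarrow> 'p \<Rightarrow> real^'n) \<Rightarrow> bool" where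
  "local_orthonormal_frame T g c U \<sigma> e \<longleftrightarrow>
     openin T U \<and> U \<subseteq> fst c \<and>
     (\<forall>i. \<sigma> i \<in> {1, -1} \<and> smooth_in c U (e i)) \<and>
     (\<forall>p\<in>U. \<forall>i j. bil (g c p) (e i p) (e j p) = (if i = j then \<sigma> i else 0))"

text \<open>\<open>w\<close> is the Laplacian at \<open>p\<close> of the field \<open>V\<close> along \<open>f\<close>, where \<open>V\<close> and \<open>w\<close> are given by
  their components in \<open>d\<close>. The value does not depend on the frame or on the chart \<open>c\<close>; note the sign.\<close>

definition is_laplacian_along ::
    "'p topology \<Rightarrow> ('p, 'n::finite) metric \<Rightarrow> ('q, 'k::finite) metric \<Rightarrow> ('p \<Rightarrow> 'q) \<Rightarrow>
     ('p, 'n) chart \<Rightarrow> ('q, 'k) chart \<Rightarrow> ('p \<Rightarrow> real^'k) \<Rightarrow> 'p \<Rightarrow> real^'k \<Rightarrow> bool" where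
  "is_laplacian_along T g g' f c d V p w \<longleftrightarrow>
     (\<exists>U \<sigma> e. p \<in> U \<and> local_orthonormal_frame T g c U \<sigma> e \<and>
        w = - (\<Sum>i\<in>UNIV. \<sigma> i *\<^sub>R
              (cov_deriv g' c d f (\<lambda>q. cov_deriv g' c d f V q (e i q)) p (e i p)
               - cov_deriv g' c d f V p (cov_deriv g c c id (e i) p (e i p)))))"

end

theory Submission
  imports Defs "HOL-Computational_Algebra.Fundamental_Theorem_Algebra"
begin

text \<open>Write \<open>n\<close> for the dimension of the hypersurface and split the equation \<open>\<Delta>(H \<xi>) = \<lambda> H \<xi>\<close> into
  its tangential and normal parts. The ambient space has constant curvature, so \<open>R(X,Y)\<xi>\<close> vanishes for
  tangent vectors \<open>X\<close>, \<open>Y\<close>; this is the Codazzi equation, and its contraction says that the divergence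
  of the shape operator \<open>A\<close> is the gradient of its trace \<open>n \<epsilon> H\<close>. With it the tangential part reads
  \<open>A (grad H) = - (n/2) \<epsilon> H grad H\<close> (\<open>shape_gradient\<close>), while the normal part at points near which \<open>H\<close>
  is constant reads \<open>H tr(A\<^sup>2) = \<epsilon> \<lambda> H\<close> (\<open>shape_square_trace\<close>).

  If \<open>A\<close> has the single eigenvalue \<open>\<mu>\<close>, then \<open>A - \<mu>\<close> is nilpotent. Comparing traces, \<open>\<mu>\<close> is the real
  number \<open>\<epsilon> H\<close> and \<open>tr(A\<^sup>2) = n H\<^sup>2\<close> (\<open>single_principal_curvature\<close>); none of this requires \<open>A\<close> to be
  diagonalizable. Where \<open>H \<noteq> 0\<close>, a nonzero gradient would be an eigenvector of \<open>A\<close> for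
  \<open>- (n/2) \<epsilon> H\<close>, which differs from \<open>\<epsilon> H\<close>. Hence \<open>H\<close> is locally constant on the open set \<open>H \<noteq> 0\<close>,
  and the normal part gives \<open>n H\<^sup>2 = \<epsilon> \<lambda>\<close> there (\<open>mean_curvature_dichotomy\<close>). So the continuous function
  \<open>H\<^sup>2\<close> has no values other than \<open>0\<close> and \<open>\<epsilon> \<lambda> / n\<close>, and it is constant on connected components.

  The differential geometry is done in one chart of each manifold, with maps between open subsets of
  Euclidean spaces, Christoffel symbols and covariant derivatives of fields along the immersion. An
  orthonormal frame enters only through its values at a point: its derivatives cancel in the
  Laplacian (\<open>local_mean_curvature_values\<close>).\<close>

section \<open>Calculus of smooth functions\<close>

abbreviation pder :: "('a::real_normed_vector \<Rightarrow> 'b::real_normed_vector) \<Rightarrow> 'a \<Rightarrow> 'a \<Rightarrow> 'b" ("\<partial>")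
  where "\<partial> f x v \<equiv> frechet_derivative f (at x) v"

lemma pder_eq: "(f has_derivative f') (at x) \<Longrightarrow> \<partial> f x v = f' v"
  by (metis frechet_derivative_at)

lemma pder_cong_open:
  assumes "open S" "x \<in> S" "\<And>y. y \<in> S \<Longrightarrow> f y = g y"
  shows "\<partial> f x v = \<partial> g x v"
proof -
  have "(f has_derivative D) (at x) \<longleftrightarrow> (g has_derivative D) (at x)" for D
    using assms by (metis has_derivative_transform_within_open)
  then show ?thesis unfolding frechet_derivative_def by simp
qed

lemma differentiable_cong_open:
  assumes "open S" "x \<in> S" "\<And>y. y \<in> S \<Longrightarrow> f y = g y" "f differentiable (at x)"
  shows "g differentiable (at x)"
  using assms unfolding differentiable_def by (metis has_derivative_transform_within_open)

lemma ck_on_cong: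
  assumes "open S"
  shows "(\<And>y. y \<in> S \<Longrightarrow> f y = g y) \<Longrightarrow> ck_on k S f \<Longrightarrow> ck_on k S g"
proof (induction k arbitrary: f g)
  case 0 then show ?case using continuous_on_cong by (metis ck_on.simps(1))
next
  case (Suc k)
  have "ck_on k S (\<lambda>x. \<partial> g x v)" for v
    using Suc.prems by (intro Suc.IH[of "\<lambda>x. \<partial> f x v" "\<lambda>x. \<partial> g x v"])
      (auto intro: pder_cong_open[OF assms])
  then show ?case using Suc.prems by (auto intro: differentiable_cong_open[OF assms, of _ f])
qed

lemma smooth_on_cong:
  assumes "open S" "\<And>y. y \<in> S \<Longrightarrow> f y = g y" "smooth_on S f"
  shows "smooth_on S g"
  using assms ck_on_cong unfolding smooth_on_def by blast

lemma ck_on_SucD: "ck_on (Suc k) S f \<Longrightarrow> ck_on k S f"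
proof (induction k arbitrary: f)
  case 0 then show ?case
    by (auto intro!: continuous_at_imp_continuous_on differentiable_imp_continuous_within)
qed auto

lemma ck_on_mono: "S \<subseteq> T \<Longrightarrow> ck_on k T f \<Longrightarrow> ck_on k S f"
  by (induction k arbitrary: f) (auto intro: continuous_on_subset)

lemma smooth_on_subset: "smooth_on T f \<Longrightarrow> S \<subseteq> T \<Longrightarrow> smooth_on S f"
  using ck_on_mono unfolding smooth_on_def by blast

lemma smooth_on_differentiable: "smooth_on S f \<Longrightarrow> x \<in> S \<Longrightarrow> f differentiable (at x)"
  unfolding smooth_on_def by (metis ck_on.simps(2))

lemma smooth_on_has_derivative: "smooth_on S f \<Longrightarrow> x \<in> S \<Longrightarrow> (f has_derivative \<partial> f x) (at x)"
  using smooth_on_differentiable frechet_derivative_works by blast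

lemma linear_pder: "smooth_on S f \<Longrightarrow> x \<in> S \<Longrightarrow> linear (\<partial> f x)"
  by (simp add: linear_frechet_derivative smooth_on_differentiable)

lemma smooth_on_pder: "smooth_on S f \<Longrightarrow> smooth_on S (\<lambda>x. \<partial> f x v)"
  unfolding smooth_on_def by (metis ck_on.simps(2))

lemma smooth_on_continuous: "smooth_on S f \<Longrightarrow> continuous_on S f"
  unfolding smooth_on_def by (metis ck_on.simps(1))

lemma ck_on_const: "ck_on k S (\<lambda>x. c)"
  by (induction k arbitrary: c) auto

lemma smooth_on_const [simp, intro]: "smooth_on S (\<lambda>x. c)"
  by (simp add: smooth_on_def ck_on_const)

lemma smooth_on_ident [simp, intro]: "smooth_on S (\<lambda>x. x)"
  unfolding smooth_on_def
proof
  fix k show "ck_on k S (\<lambda>x. x)" by (cases k) (auto simp: ck_on_const)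
qed

lemma smooth_on_id [simp, intro]: "smooth_on S id"
  by (simp add: id_def)

lemma ck_on_linear:
  assumes "open S" "bounded_linear L"
  shows "ck_on k S f \<Longrightarrow> ck_on k S (\<lambda>x. L (f x))"
proof (induction k arbitrary: f)
  case 0 then show ?case by (simp add: assms bounded_linear.continuous_on)
next
  case (Suc k)
  have d: "((\<lambda>x. L (f x)) has_derivative (\<lambda>v. L (\<partial> f x v))) (at x)" if "x \<in> S" for x
    using Suc.prems that by (intro bounded_linear.has_derivative[OF assms(2)])
      (auto simp: frechet_derivative_works)
  have "ck_on k S (\<lambda>x. L (\<partial> f x v))" for v using Suc by auto
  then have "ck_on k S (\<lambda>x. \<partial> (\<lambda>x. L (f x)) x v)" for v
    by (rule ck_on_cong[OF assms(1), rotated]) (simp add: pder_eq[OF d])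
  then show ?case using d by (auto intro: differentiableI)
qed

lemma smooth_on_linear: "open S \<Longrightarrow> bounded_linear L \<Longrightarrow> smooth_on S f \<Longrightarrow> smooth_on S (\<lambda>x. L (f x))"
  by (simp add: smooth_on_def ck_on_linear)

lemma ck_on_add:
  assumes "open S"
  shows "ck_on k S f \<Longrightarrow> ck_on k S g \<Longrightarrow> ck_on k S (\<lambda>x. f x + g x)"
proof (induction k arbitrary: f g)
  case 0 then show ?case by (simp add: continuous_on_add)
next
  case (Suc k)
  have d: "((\<lambda>x. f x + g x) has_derivative (\<lambda>v. \<partial> f x v + \<partial> g x v)) (at x)" if "x \<in> S" for x
    using Suc.prems that by (intro has_derivative_add) (auto simp: frechet_derivative_works)
  have "ck_on k S (\<lambda>x. \<partial> f x v + \<partial> g x v)" for v using Suc by auto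
  then have "ck_on k S (\<lambda>x. \<partial> (\<lambda>x. f x + g x) x v)" for v
    by (rule ck_on_cong[OF assms(1), rotated]) (simp add: pder_eq[OF d])
  then show ?case using d by (auto intro: differentiableI)
qed

lemma ck_on_bilinear:
  assumes "open S" "bounded_bilinear B"
  shows "ck_on k S f \<Longrightarrow> ck_on k S g \<Longrightarrow> ck_on k S (\<lambda>x. B (f x) (g x))"
proof (induction k arbitrary: f g)
  case 0 then show ?case by (simp add: assms bounded_bilinear.continuous_on)
next
  case (Suc k)
  have d: "((\<lambda>x. B (f x) (g x)) has_derivative (\<lambda>v. B (f x) (\<partial> g x v) + B (\<partial> f x v) (g x))) (at x)"
    if "x \<in> S" for x
    using Suc.prems that by (intro bounded_bilinear.FDERIV[OF assms(2)])
      (auto simp: frechet_derivative_works)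
  have "ck_on k S (\<lambda>x. B (f x) (\<partial> g x v) + B (\<partial> f x v) (g x))" for v
    using Suc.prems by (intro ck_on_add Suc.IH assms) (auto intro: ck_on_SucD)
  then have "ck_on k S (\<lambda>x. \<partial> (\<lambda>x. B (f x) (g x)) x v)" for v
    by (rule ck_on_cong[OF assms(1), rotated]) (simp add: pder_eq[OF d])
  then show ?case using d by (auto intro: differentiableI)
qed

lemma smooth_on_add: "open S \<Longrightarrow> smooth_on S f \<Longrightarrow> smooth_on S g \<Longrightarrow> smooth_on S (\<lambda>x. f x + g x)"
  by (simp add: smooth_on_def ck_on_add)

lemma smooth_on_bilinear:
  "bounded_bilinear B \<Longrightarrow> open S \<Longrightarrow> smooth_on S f \<Longrightarrow> smooth_on S g \<Longrightarrow> smooth_on S (\<lambda>x. B (f x) (g x))"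
  by (simp add: smooth_on_def ck_on_bilinear)

lemmas smooth_on_scaleR = smooth_on_bilinear[OF bounded_bilinear_scaleR]
lemmas smooth_on_mult = smooth_on_bilinear[OF bounded_bilinear_mult]

lemma smooth_on_minus: "open S \<Longrightarrow> smooth_on S f \<Longrightarrow> smooth_on S (\<lambda>x. - f x)"
  by (rule smooth_on_linear[OF _ bounded_linear_minus[OF bounded_linear_ident]])

lemma smooth_on_diff: "open S \<Longrightarrow> smooth_on S f \<Longrightarrow> smooth_on S g \<Longrightarrow> smooth_on S (\<lambda>x. f x - g x)"
  using smooth_on_add[of S f "\<lambda>x. - g x"] by (simp add: smooth_on_minus)

lemma smooth_on_nth: "open S \<Longrightarrow> smooth_on S f \<Longrightarrow> smooth_on S (\<lambda>x. f x $ i)"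
  by (rule smooth_on_linear[OF _ bounded_linear_vec_nth])

lemma ck_on_sum:
  assumes "open S" "\<And>i. i \<in> I \<Longrightarrow> ck_on k S (f i)"
  shows "ck_on k S (\<lambda>x. \<Sum>i\<in>I. f i x)"
  using assms by (induction I rule: infinite_finite_induct) (auto simp: ck_on_const ck_on_add)

lemma smooth_on_sum:
  "open S \<Longrightarrow> (\<And>i. i \<in> I \<Longrightarrow> smooth_on S (f i)) \<Longrightarrow> smooth_on S (\<lambda>x. \<Sum>i\<in>I. f i x)"
  by (simp add: smooth_on_def ck_on_sum)

lemma smooth_on_prod:
  fixes f :: "'i \<Rightarrow> 'a::real_normed_vector \<Rightarrow> real"
  assumes "open S" "\<And>i. i \<in> I \<Longrightarrow> smooth_on S (f i)"
  shows "smooth_on S (\<lambda>x. \<Prod>i\<in>I. f i x)"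
  using assms by (induction I rule: infinite_finite_induct) (auto intro!: smooth_on_mult)

lemma smooth_on_vec:
  fixes f :: "'a::real_normed_vector \<Rightarrow> 'n::finite \<Rightarrow> 'b::euclidean_space"
  assumes "open S" "\<And>i. smooth_on S (\<lambda>x. f x i)"
  shows "smooth_on S (\<lambda>x. \<chi> i. f x i)"
proof -
  have *: "(\<chi> i. f x i) = (\<Sum>i\<in>UNIV. axis i (f x i))" for x
    by (simp add: vec_eq_iff axis_def if_distrib sum.delta cong: if_cong)
  have "bounded_linear (\<lambda>y::'b. axis i y :: 'b^'n)" for i
    by (rule linear_conv_bounded_linear[THEN iffD1]) (auto simp: linear_iff axis_def vec_eq_iff)
  then show ?thesis unfolding * using assms
    by (intro smooth_on_sum) (auto intro: smooth_on_linear)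
qed

text \<open>The chain rule, written in a basis, turns a derivative of \<open>g \<circ> f\<close> into products of derivatives
  of \<open>f\<close> with functions of the same shape \<open>g' \<circ> f\<close>; this is what makes the induction on the order
  of differentiability work.\<close>

lemma smooth_on_compose:
  fixes f :: "'a::real_normed_vector \<Rightarrow> 'b::euclidean_space" and g :: "'b \<Rightarrow> 'c::real_normed_vector"
  assumes S: "open S" and f: "smooth_on S f" and g: "smooth_on T g" and sub: "\<And>x. x \<in> S \<Longrightarrow> f x \<in> T"
  shows "smooth_on S (\<lambda>x. g (f x))"
proof -
  have "smooth_on T g \<Longrightarrow> ck_on k S (\<lambda>x. g (f x))" for k
  proof (induction k arbitrary: g)
    case 0
    then show ?case
      using continuous_on_compose2[OF smooth_on_continuous smooth_on_continuous[OF f]] sub by auto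
  next
    case (Suc k)
    have d: "((\<lambda>x. g (f x)) has_derivative (\<lambda>v. \<partial> g (f x) (\<partial> f x v))) (at x)" if "x \<in> S" for x
      using diff_chain_at[OF smooth_on_has_derivative[OF f that] smooth_on_has_derivative[OF Suc.prems sub[OF that]]]
      by (simp add: o_def)
    have lin: "\<partial> g (f x) w = (\<Sum>i\<in>Basis. (w \<bullet> i) *\<^sub>R \<partial> g (f x) i)" if "x \<in> S" for x w
      by (subst euclidean_representation[of w, symmetric])
        (simp add: linear_sum[OF linear_pder[OF Suc.prems sub[OF that]]]
          linear_cmul[OF linear_pder[OF Suc.prems sub[OF that]]])
    have "ck_on k S (\<lambda>x. \<Sum>i\<in>Basis. (\<partial> f x v \<bullet> i) *\<^sub>R \<partial> g (f x) i)" for v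
    proof (rule ck_on_sum[OF S], rule ck_on_bilinear[OF S bounded_bilinear_scaleR])
      fix i :: 'b
      show "ck_on k S (\<lambda>x. \<partial> f x v \<bullet> i)"
        using smooth_on_linear[OF S bounded_linear_inner_left smooth_on_pder[OF f]]
        by (auto simp: smooth_on_def)
      show "ck_on k S (\<lambda>x. \<partial> g (f x) i)"
        by (rule Suc.IH[OF smooth_on_pder[OF Suc.prems]])
    qed
    then have "ck_on k S (\<lambda>x. \<partial> (\<lambda>x. g (f x)) x v)" for v
      by (rule ck_on_cong[OF S, rotated]) (rule trans[OF lin[symmetric] pder_eq[OF d, symmetric]])
    then show ?case using d by (auto intro: differentiableI)
  qed
  then show ?thesis using g by (simp add: smooth_on_def)
qed

lemma smooth_on_inverse:
  fixes f :: "'a::real_normed_vector \<Rightarrow> real"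
  assumes S: "open S" and f: "smooth_on S f" and nz: "\<And>x. x \<in> S \<Longrightarrow> f x \<noteq> 0"
  shows "smooth_on S (\<lambda>x. inverse (f x))"
  unfolding smooth_on_def
proof
  fix k
  have d: "((\<lambda>x. inverse (f x)) has_derivative (\<lambda>v. - (inverse (f x) * \<partial> f x v * inverse (f x)))) (at x)"
    if "x \<in> S" for x
    by (rule Deriv.has_derivative_inverse[OF nz[OF that] smooth_on_has_derivative[OF f that]])
  show "ck_on k S (\<lambda>x. inverse (f x))"
  proof (induction k)
    case 0
    then show ?case using smooth_on_continuous[OF f] nz by (simp add: continuous_on_inverse)
  next
    case (Suc k)
    have e: "ck_on k S (\<lambda>x. - (inverse (f x) * \<partial> f x v * inverse (f x)))" for v
    proof (rule ck_on_linear[OF S bounded_linear_minus[OF bounded_linear_ident]],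
        (rule ck_on_bilinear[OF S bounded_bilinear_mult])+)
      show "ck_on k S (\<lambda>x. \<partial> f x v)" using smooth_on_pder[OF f] by (simp add: smooth_on_def)
    qed (fact Suc)+
    have "ck_on k S (\<lambda>x. \<partial> (\<lambda>x. inverse (f x)) x v)" for v
      by (rule ck_on_cong[OF S _ e[of v]]) (simp add: pder_eq[OF d])
    then show ?case using d by (auto intro: differentiableI)
  qed
qed

lemma smooth_on_det:
  fixes M :: "'a::real_normed_vector \<Rightarrow> real^'n^'n"
  assumes "open S" "\<And>i j. smooth_on S (\<lambda>x. M x $ i $ j)"
  shows "smooth_on S (\<lambda>x. det (M x))"
  unfolding det_def using assms
  by (intro smooth_on_sum smooth_on_mult smooth_on_prod smooth_on_const) auto

lemma matrix_inv_mult: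
  fixes G :: "real^'n^'n"
  assumes "invertible G"
  shows "matrix_inv G *v (G *v x) = x" "G *v (matrix_inv G *v x) = x"
proof -
  have "G ** matrix_inv G = mat 1 \<and> matrix_inv G ** G = mat 1"
    using assms unfolding invertible_def matrix_inv_def by (rule someI_ex)
  then show "matrix_inv G *v (G *v x) = x" "G *v (matrix_inv G *v x) = x"
    by (simp_all add: matrix_vector_mul_assoc)
qed

text \<open>Cramer's rule writes the solution of a linear system as a quotient of polynomials in the entries, so
  smoothness of determinants and of reciprocals is all that is used about matrix inversion.\<close>

lemma smooth_on_matrix_inv:
  fixes M :: "'a::real_normed_vector \<Rightarrow> real^'n^'n"
  assumes S: "open S" and M: "smooth_on S M" and inv: "\<And>x. x \<in> S \<Longrightarrow> invertible (M x)"
    and b: "smooth_on S b"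
  shows "smooth_on S (\<lambda>x. matrix_inv (M x) *v b x)"
proof -
  have M': "smooth_on S (\<lambda>x. M x $ i $ j)" for i j by (intro smooth_on_nth S M)
  have cr: "matrix_inv (M x) *v b x =
      (\<chi> k. det (\<chi> i j. if j = k then b x $ i else M x $ i $ j) * inverse (det (M x)))" if "x \<in> S" for x
    using iffD1[OF cramer matrix_inv_mult(2)[OF inv[OF that]], of "b x"] inv[OF that]
    by (simp add: invertible_det_nz divide_inverse)
  have "smooth_on S (\<lambda>x. \<chi> k. det (\<chi> i j. if j = k then b x $ i else M x $ i $ j) * inverse (det (M x)))"
  proof (intro smooth_on_vec smooth_on_mult smooth_on_inverse smooth_on_det S)
    fix i j k
    show "smooth_on S (\<lambda>x. (\<chi> i j. if j = k then b x $ i else M x $ i $ j) $ i $ j)"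
      by (cases "j = k") (auto simp: M' intro: smooth_on_nth[OF S b])
  qed (use M' inv in \<open>auto simp: invertible_det_nz\<close>)
  then show ?thesis by (rule smooth_on_cong[OF S, rotated]) (simp add: cr)
qed

text \<open>Product rules for fields of linear and bilinear maps. Smoothness of such a field is expressed by
  evaluating it on constant vectors, so that derivatives \<open>\<partial> f x\<close>, metrics and Christoffel symbols all
  fit without a norm on a space of maps; an expansion in a basis reduces to ordinary products.\<close>

lemma
  fixes L :: "'a::real_normed_vector \<Rightarrow> 'b::euclidean_space \<Rightarrow> 'c::real_normed_vector"
  assumes S: "open S" and lin: "\<And>x. x \<in> S \<Longrightarrow> linear (L x)"
    and L: "\<And>u. smooth_on S (\<lambda>x. L x u)" and U: "smooth_on S U"
  shows smooth_on_linear_family: "smooth_on S (\<lambda>x. L x (U x))"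
    and pder_linear_family: "\<And>x v. x \<in> S \<Longrightarrow>
      \<partial> (\<lambda>y. L y (U y)) x v = \<partial> (\<lambda>y. L y (U x)) x v + L x (\<partial> U x v)"
proof -
  have ex: "L x u = (\<Sum>i\<in>Basis. (u \<bullet> i) *\<^sub>R L x i)" if "x \<in> S" for x u
    by (subst euclidean_representation[of u, symmetric])
      (simp add: linear_sum[OF lin[OF that]] linear_cmul[OF lin[OF that]])
  have Ui: "smooth_on S (\<lambda>x. U x \<bullet> i)" for i
    by (rule smooth_on_linear[OF S bounded_linear_inner_left U])
  have "smooth_on S (\<lambda>x. \<Sum>i\<in>Basis. (U x \<bullet> i) *\<^sub>R L x i)"
    by (intro smooth_on_sum smooth_on_scaleR S Ui L)
  then show "smooth_on S (\<lambda>x. L x (U x))"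
    by (rule smooth_on_cong[OF S, rotated]) (metis ex)
  fix x v assume x: "x \<in> S"
  have dU: "(U has_derivative \<partial> U x) (at x)" by (rule smooth_on_has_derivative[OF U x])
  have dL: "((\<lambda>y. L y u) has_derivative \<partial> (\<lambda>y. L y u) x) (at x)" for u
    by (rule smooth_on_has_derivative[OF L x])
  have 1: "((\<lambda>y. L y u) has_derivative (\<lambda>v. \<Sum>i\<in>Basis. (u \<bullet> i) *\<^sub>R \<partial> (\<lambda>y. L y i) x v)) (at x)" for u
  proof (rule has_derivative_transform_within_open[OF _ S x])
    show "((\<lambda>y. \<Sum>i\<in>Basis. (u \<bullet> i) *\<^sub>R L y i) has_derivative
        (\<lambda>v. \<Sum>i\<in>Basis. (u \<bullet> i) *\<^sub>R \<partial> (\<lambda>y. L y i) x v)) (at x)"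
      by (intro has_derivative_sum has_derivative_scaleR_right dL)
  qed (metis ex)
  have 2: "((\<lambda>y. L y (U y)) has_derivative
      (\<lambda>v. \<Sum>i\<in>Basis. (U x \<bullet> i) *\<^sub>R \<partial> (\<lambda>y. L y i) x v + (\<partial> U x v \<bullet> i) *\<^sub>R L x i)) (at x)"
  proof (rule has_derivative_transform_within_open[OF _ S x])
    show "((\<lambda>y. \<Sum>i\<in>Basis. (U y \<bullet> i) *\<^sub>R L y i) has_derivative
      (\<lambda>v. \<Sum>i\<in>Basis. (U x \<bullet> i) *\<^sub>R \<partial> (\<lambda>y. L y i) x v + (\<partial> U x v \<bullet> i) *\<^sub>R L x i)) (at x)"
      by (intro has_derivative_sum has_derivative_scaleR has_derivative_inner_left dL dU)
  qed (metis ex)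
  show "\<partial> (\<lambda>y. L y (U y)) x v = \<partial> (\<lambda>y. L y (U x)) x v + L x (\<partial> U x v)"
    unfolding pder_eq[OF 1, of "U x"] pder_eq[OF 2] ex[OF x, of "\<partial> U x v"]
    by (rule sum.distrib)
qed

lemma
  fixes B :: "'a::real_normed_vector \<Rightarrow> 'b::euclidean_space \<Rightarrow> 'c::euclidean_space \<Rightarrow> 'd::real_normed_vector"
  assumes S: "open S" and lin1: "\<And>x v. x \<in> S \<Longrightarrow> linear (\<lambda>u. B x u v)"
    and lin2: "\<And>x u. x \<in> S \<Longrightarrow> linear (B x u)"
    and B: "\<And>u v. smooth_on S (\<lambda>x. B x u v)" and U: "smooth_on S U" and V: "smooth_on S V"
  shows smooth_on_bilinear_family: "smooth_on S (\<lambda>x. B x (U x) (V x))"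
    and pder_bilinear_family: "\<And>x h. x \<in> S \<Longrightarrow> \<partial> (\<lambda>y. B y (U y) (V y)) x h =
      \<partial> (\<lambda>y. B y (U x) (V x)) x h + B x (\<partial> U x h) (V x) + B x (U x) (\<partial> V x h)"
proof -
  have s: "smooth_on S (\<lambda>x. B x u (V x))" for u
    by (rule smooth_on_linear_family[OF S, where L = "\<lambda>x. B x u"]) (fact lin2 B V)+
  show "smooth_on S (\<lambda>x. B x (U x) (V x))"
    by (rule smooth_on_linear_family[OF S, where L = "\<lambda>x u. B x u (V x)"]) (fact lin1 s U)+
  fix x h assume x: "x \<in> S"
  have "\<partial> (\<lambda>y. B y (U y) (V y)) x h = \<partial> (\<lambda>y. B y (U x) (V y)) x h + B x (\<partial> U x h) (V x)"
    by (rule pder_linear_family[OF S, where L = "\<lambda>x u. B x u (V x)"]) (fact lin1 s U x)+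
  also have "\<partial> (\<lambda>y. B y (U x) (V y)) x h = \<partial> (\<lambda>y. B y (U x) (V x)) x h + B x (U x) (\<partial> V x h)"
    by (rule pder_linear_family[OF S, where L = "\<lambda>y. B y (U x)"]) (fact lin2 B V x)+
  finally show "\<partial> (\<lambda>y. B y (U y) (V y)) x h =
      \<partial> (\<lambda>y. B y (U x) (V x)) x h + B x (\<partial> U x h) (V x) + B x (U x) (\<partial> V x h)" by simp
qed

lemma pder_compose:
  assumes "smooth_on S f" "smooth_on T g" "x \<in> S" "f x \<in> T"
  shows "\<partial> (\<lambda>x. g (f x)) x v = \<partial> g (f x) (\<partial> f x v)"
proof -
  have "((\<lambda>x. g (f x)) has_derivative (\<lambda>v. \<partial> g (f x) (\<partial> f x v))) (at x)"
    using diff_chain_at[OF smooth_on_has_derivative[OF assms(1,3)] smooth_on_has_derivative[OF assms(2,4)]]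
    by (simp add: o_def)
  then show ?thesis by (rule pder_eq)
qed

lemma pder_linear:
  assumes "bounded_linear L" "smooth_on S f" "x \<in> S"
  shows "\<partial> (\<lambda>x. L (f x)) x v = L (\<partial> f x v)"
  using bounded_linear.has_derivative[OF assms(1) smooth_on_has_derivative[OF assms(2,3)]]
  by (rule pder_eq)

lemma pder_add:
  assumes "smooth_on S f" "smooth_on S g" "x \<in> S"
  shows "\<partial> (\<lambda>x. f x + g x) x v = \<partial> f x v + \<partial> g x v"
  using has_derivative_add[OF assms(1,2)[THEN smooth_on_has_derivative[OF _ assms(3)]]]
  by (rule pder_eq)

lemma pder_scaleR:
  assumes "smooth_on S f" "smooth_on S g" "x \<in> S"
  shows "\<partial> (\<lambda>x. f x *\<^sub>R g x) x v = \<partial> f x v *\<^sub>R g x + f x *\<^sub>R \<partial> g x v"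
  using pder_eq[OF has_derivative_scaleR[OF assms(1,2)[THEN smooth_on_has_derivative[OF _ assms(3)]]]]
  by simp

text \<open>Symmetry of second derivatives. Two applications of the mean value theorem in either order
  express the same second difference over a small parallelogram spanned by \<open>h u\<close> and \<open>h v\<close> through
  either mixed derivative at a nearby point.\<close>

lemma second_difference_mean_value:
  fixes f :: "'a::real_normed_vector \<Rightarrow> real"
  assumes f: "smooth_on S f" and h: "0 < h"
    and seg: "\<And>s t. 0 \<le> s \<Longrightarrow> s \<le> h \<Longrightarrow> 0 \<le> t \<Longrightarrow> t \<le> h \<Longrightarrow> x + s *\<^sub>R u + t *\<^sub>R v \<in> S"
  shows "\<exists>s t. 0 \<le> s \<and> s \<le> h \<and> 0 \<le> t \<and> t \<le> h \<and>
    f (x + h *\<^sub>R u + h *\<^sub>R v) - f (x + h *\<^sub>R u) - (f (x + h *\<^sub>R v) - f x) =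
    h * h * \<partial> (\<lambda>y. \<partial> f y u) (x + s *\<^sub>R u + t *\<^sub>R v) v"
proof -
  have d: "((\<lambda>s. g (a + s *\<^sub>R w)) has_real_derivative \<partial> g (a + s *\<^sub>R w) w) (at s)"
    if "smooth_on S g" "a + s *\<^sub>R w \<in> S" for g :: "'a \<Rightarrow> real" and a w s
  proof -
    have "((\<lambda>s. a + s *\<^sub>R w) has_derivative (\<lambda>s. 0 + s *\<^sub>R w)) (at s)"
      by (intro has_derivative_add has_derivative_const has_derivative_scaleR_left has_derivative_ident)
    from diff_chain_at[OF this smooth_on_has_derivative[OF that]]
    have "((\<lambda>s. g (a + s *\<^sub>R w)) has_derivative (\<lambda>t. \<partial> g (a + s *\<^sub>R w) (t *\<^sub>R w))) (at s)"
      by (simp add: o_def)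
    moreover have "(\<lambda>t. \<partial> g (a + s *\<^sub>R w) (t *\<^sub>R w)) = (*) (\<partial> g (a + s *\<^sub>R w) w)"
      using linear_cmul[OF linear_pder[OF that]] by (simp add: fun_eq_iff mult.commute)
    ultimately show ?thesis by (simp only: has_field_derivative_def)
  qed
  define \<phi> where "\<phi> s = f ((x + h *\<^sub>R v) + s *\<^sub>R u) - f (x + s *\<^sub>R u)" for s
  have "\<exists>s. 0 < s \<and> s < h \<and> \<phi> h - \<phi> 0 = (h - 0) * (\<partial> f ((x + h *\<^sub>R v) + s *\<^sub>R u) u - \<partial> f (x + s *\<^sub>R u) u)"
    unfolding \<phi>_def
  proof (rule MVT2[OF h], intro DERIV_diff)
    fix s assume s: "0 \<le> s" "s \<le> h"
    show "((\<lambda>s. f ((x + h *\<^sub>R v) + s *\<^sub>R u)) has_real_derivative \<partial> f ((x + h *\<^sub>R v) + s *\<^sub>R u) u) (at s)"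
      using seg[of s h] s h by (intro d f) (simp add: ac_simps)
    show "((\<lambda>s. f (x + s *\<^sub>R u)) has_real_derivative \<partial> f (x + s *\<^sub>R u) u) (at s)"
      using seg[of s 0] s h by (intro d f) (simp add: ac_simps)
  qed
  then obtain s where s: "0 < s" "s < h"
    and 1: "\<phi> h - \<phi> 0 = h * (\<partial> f (x + s *\<^sub>R u + h *\<^sub>R v) u - \<partial> f (x + s *\<^sub>R u) u)"
    by (auto simp: ac_simps)
  have "\<exists>t. 0 < t \<and> t < h \<and> \<partial> f ((x + s *\<^sub>R u) + h *\<^sub>R v) u - \<partial> f ((x + s *\<^sub>R u) + 0 *\<^sub>R v) u =
      (h - 0) * \<partial> (\<lambda>y. \<partial> f y u) ((x + s *\<^sub>R u) + t *\<^sub>R v) v"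
    by (rule MVT2[OF h]) (use seg s in \<open>auto intro!: d[OF smooth_on_pder[OF f]]\<close>)
  then obtain t where "0 < t" "t < h" "\<phi> h - \<phi> 0 = h * (h * \<partial> (\<lambda>y. \<partial> f y u) (x + s *\<^sub>R u + t *\<^sub>R v) v)"
    using 1 by auto
  then show ?thesis using s
    by (intro exI[of _ s] exI[of _ t]) (simp add: \<phi>_def algebra_simps)
qed

lemma second_pder_commute_real:
  fixes f :: "'a::real_normed_vector \<Rightarrow> real"
  assumes S: "open S" and f: "smooth_on S f" and x: "x \<in> S"
  shows "\<partial> (\<lambda>y. \<partial> f y u) x v = \<partial> (\<lambda>y. \<partial> f y v) x u"
proof (rule ccontr)
  let ?a = "\<lambda>y. \<partial> (\<lambda>y. \<partial> f y u) y v" and ?b = "\<lambda>y. \<partial> (\<lambda>y. \<partial> f y v) y u"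
  assume ne: "?a x \<noteq> ?b x"
  define e where "e = \<bar>?a x - ?b x\<bar> / 2"
  have e: "e > 0" using ne by (simp add: e_def)
  have c: "continuous (at x) ?a" "continuous (at x) ?b"
    using smooth_on_continuous[OF smooth_on_pder[OF smooth_on_pder[OF f]]] S x
    by (auto simp: continuous_on_eq_continuous_at)
  obtain d1 where d1: "d1 > 0" "\<And>y. dist y x < d1 \<Longrightarrow> \<bar>?a y - ?a x\<bar> < e"
    using c(1) e unfolding continuous_at_eps_delta dist_real_def by blast
  obtain d2 where d2: "d2 > 0" "\<And>y. dist y x < d2 \<Longrightarrow> \<bar>?b y - ?b x\<bar> < e"
    using c(2) e unfolding continuous_at_eps_delta dist_real_def by blast
  obtain d3 where d3: "d3 > 0" "\<And>y. dist y x < d3 \<Longrightarrow> y \<in> S"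
    using S x unfolding open_dist by blast
  define d where "d = min d1 (min d2 d3)"
  define h where "h = d / (2 * (norm u + norm v + 1))"
  have d: "d > 0" using d1 d2 d3 by (simp add: d_def)
  have N: "norm u + norm v + 1 > 0" by (simp add: add_nonneg_pos)
  have h: "h > 0" using d N by (simp add: h_def)
  have near: "dist (x + s *\<^sub>R u + t *\<^sub>R v) x < d" if "0 \<le> s" "s \<le> h" "0 \<le> t" "t \<le> h" for s t
  proof -
    have "dist (x + s *\<^sub>R u + t *\<^sub>R v) x = norm (s *\<^sub>R u + t *\<^sub>R v)" by (simp add: dist_norm)
    also have "\<dots> \<le> s * norm u + t * norm v"
      using norm_triangle_ineq[of "s *\<^sub>R u" "t *\<^sub>R v"] that by simp
    also have "\<dots> \<le> h * norm u + h * norm v" using that by (intro add_mono mult_right_mono) auto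
    also have "\<dots> \<le> h * (norm u + norm v + 1)" using h by (simp add: algebra_simps)
    also have "\<dots> = d / 2" using N unfolding h_def by (simp only: times_divide_eq_left) (simp add: divide_simps)
    also have "\<dots> < d" using d by simp
    finally show ?thesis .
  qed
  have near': "dist (x + s *\<^sub>R v + t *\<^sub>R u) x < d" if "0 \<le> s" "s \<le> h" "0 \<le> t" "t \<le> h" for s t
    using near[of t s] that by (simp only: add.assoc add.commute[of "s *\<^sub>R v"])
  have in_S: "x + s *\<^sub>R u + t *\<^sub>R v \<in> S" and in_S': "x + s *\<^sub>R v + t *\<^sub>R u \<in> S"
    if "0 \<le> s" "s \<le> h" "0 \<le> t" "t \<le> h" for s t
    using near[OF that] near'[OF that] d3(2) by (simp_all add: d_def)
  obtain s t where st: "0 \<le> s" "s \<le> h" "0 \<le> t" "t \<le> h" and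
    1: "f (x + h *\<^sub>R u + h *\<^sub>R v) - f (x + h *\<^sub>R u) - (f (x + h *\<^sub>R v) - f x) = h * h * ?a (x + s *\<^sub>R u + t *\<^sub>R v)"
    using second_difference_mean_value[OF f h, of x u v] in_S by blast
  obtain s' t' where st': "0 \<le> s'" "s' \<le> h" "0 \<le> t'" "t' \<le> h" and
    2: "f (x + h *\<^sub>R v + h *\<^sub>R u) - f (x + h *\<^sub>R v) - (f (x + h *\<^sub>R u) - f x) = h * h * ?b (x + s' *\<^sub>R v + t' *\<^sub>R u)"
    using second_difference_mean_value[OF f h, of x v u] in_S' by blast
  have swap: "x + h *\<^sub>R v + h *\<^sub>R u = x + h *\<^sub>R u + h *\<^sub>R v" by simp
  have "h * h * ?a (x + s *\<^sub>R u + t *\<^sub>R v) = h * h * ?b (x + s' *\<^sub>R v + t' *\<^sub>R u)"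
    using 1 2 unfolding swap by linarith
  then have "?a (x + s *\<^sub>R u + t *\<^sub>R v) = ?b (x + s' *\<^sub>R v + t' *\<^sub>R u)" using h by simp
  moreover have "\<bar>?a (x + s *\<^sub>R u + t *\<^sub>R v) - ?a x\<bar> < e" using near[OF st] d1 by (simp add: d_def)
  moreover have "\<bar>?b (x + s' *\<^sub>R v + t' *\<^sub>R u) - ?b x\<bar> < e" using near'[OF st'] d2 by (simp add: d_def)
  moreover have False if "a = b" "\<bar>a - p\<bar> < \<bar>p - q\<bar> / 2" "\<bar>b - q\<bar> < \<bar>p - q\<bar> / 2" for a b p q :: real
    using that by (simp add: abs_if split: if_splits)
  ultimately show False unfolding e_def by blast
qed

lemma second_pder_commute:
  fixes f :: "'a::real_normed_vector \<Rightarrow> 'b::euclidean_space"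
  assumes S: "open S" and f: "smooth_on S f" and x: "x \<in> S"
  shows "\<partial> (\<lambda>y. \<partial> f y u) x v = \<partial> (\<lambda>y. \<partial> f y v) x u"
proof (rule euclidean_eqI)
  fix i :: 'b
  have fi: "smooth_on S (\<lambda>y. f y \<bullet> i)" by (rule smooth_on_linear[OF S bounded_linear_inner_left f])
  have *: "\<partial> (\<lambda>y. \<partial> f y u) x v \<bullet> i = \<partial> (\<lambda>y. \<partial> (\<lambda>y. f y \<bullet> i) y u) x v" for u v
  proof -
    have "\<partial> (\<lambda>y. \<partial> f y u) x v \<bullet> i = \<partial> (\<lambda>y. \<partial> f y u \<bullet> i) x v"
      by (simp only: pder_linear[OF bounded_linear_inner_left smooth_on_pder[OF f] x])
    also have "\<dots> = \<partial> (\<lambda>y. \<partial> (\<lambda>y. f y \<bullet> i) y u) x v"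
      by (rule pder_cong_open[OF S x]) (simp only: pder_linear[OF bounded_linear_inner_left f])
    finally show ?thesis .
  qed
  show "\<partial> (\<lambda>y. \<partial> f y u) x v \<bullet> i = \<partial> (\<lambda>y. \<partial> f y v) x u \<bullet> i"
    unfolding * by (rule second_pder_commute_real[OF S fi x])
qed

section \<open>The Levi-Civita connection in coordinates\<close>

lemma linear_bil_right: "linear (bil M u)"
  by (rule linearI) (simp_all add: bil_def matrix_vector_right_distrib inner_add_right
      matrix_vector_mult_scaleR)

lemma linear_bil_left: "linear (\<lambda>u. bil M u v)"
  by (rule linearI) (simp_all add: bil_def inner_add_left)

lemma linear_bil_matrix: "linear (\<lambda>M. bil M u v)"
  by (rule linearI) (simp_all add: bil_def matrix_vector_mult_add_rdistrib inner_add_right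
      scaleR_matrix_vector_assoc[symmetric])

lemmas bil_add = linear_add[OF linear_bil_left] linear_add[OF linear_bil_right]
lemmas bil_diff = linear_diff[OF linear_bil_left] linear_diff[OF linear_bil_right]
lemmas bil_scaleR = linear_cmul[OF linear_bil_left] linear_cmul[OF linear_bil_right]
lemmas bil_minus = linear_neg[OF linear_bil_left] linear_neg[OF linear_bil_right]
lemmas bil_sum = linear_sum[OF linear_bil_left] linear_sum[OF linear_bil_right]
lemmas bil_zero = linear_0[OF linear_bil_left] linear_0[OF linear_bil_right]

lemma linear_axis_expansion:
  fixes f :: "real^'k \<Rightarrow> real"
  assumes "linear f"
  shows "f w = (\<Sum>l\<in>UNIV. w $ l * f (axis l 1))"
proof -
  have "f w = f (\<Sum>l\<in>UNIV. (w $ l) *\<^sub>R axis l 1)"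
    using basis_expansion[of w] by (simp add: scalar_mult_eq_scaleR)
  then show ?thesis by (simp add: linear_sum[OF assms] linear_cmul[OF assms])
qed

text \<open>Coordinate expressions of the Christoffel symbols, of the covariant derivative of a field \<open>V\<close> along
  \<open>F\<close> and of the curvature tensor. The charts are absorbed into the functions, and \<open>F = id\<close> gives the
  covariant derivative of vector fields.\<close>

definition Christoffel :: "(real^'k \<Rightarrow> real^'k^'k) \<Rightarrow> real^'k \<Rightarrow> real^'k \<Rightarrow> real^'k \<Rightarrow> real^'k" where
  "Christoffel G y u v = matrix_inv (G y) *v
     (\<chi> l. (\<partial> (\<lambda>z. bil (G z) v (axis l 1)) y u + \<partial> (\<lambda>z. bil (G z) u (axis l 1)) y v
           - \<partial> (\<lambda>z. bil (G z) u v) y (axis l 1)) / 2)"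

definition cov :: "(real^'k \<Rightarrow> real^'k^'k) \<Rightarrow> (real^'n \<Rightarrow> real^'k) \<Rightarrow> (real^'n \<Rightarrow> real^'k) \<Rightarrow>
    real^'n \<Rightarrow> real^'n \<Rightarrow> real^'k" where
  "cov G F V x h = \<partial> V x h + Christoffel G (F x) (\<partial> F x h) (V x)"

lemma cov_cong_open:
  assumes "open S" "x \<in> S" "\<And>q. q \<in> S \<Longrightarrow> U q = V q"
  shows "cov G F U x u = cov G F V x u"
  using pder_cong_open[OF assms] assms by (simp add: cov_def)

definition riem :: "(real^'k \<Rightarrow> real^'k^'k) \<Rightarrow> real^'k \<Rightarrow> real^'k \<Rightarrow> real^'k \<Rightarrow> real^'k \<Rightarrow> real^'k" where
  "riem G y u v w = cov G id (\<lambda>q. cov G id (\<lambda>_. w) q v) y u - cov G id (\<lambda>q. cov G id (\<lambda>_. w) q u) y v"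

locale metric_region =
  fixes W :: "(real^'k::finite) set" and G :: "real^'k \<Rightarrow> real^'k^'k"
  assumes open_W: "open W" and smooth_G: "smooth_on W G"
    and sym: "y \<in> W \<Longrightarrow> bil (G y) u v = bil (G y) v u"
    and nondeg: "y \<in> W \<Longrightarrow> (\<And>v. bil (G y) u v = 0) \<Longrightarrow> u = 0"
begin

lemma invertible_G: "y \<in> W \<Longrightarrow> invertible (G y)"
  unfolding invertible_left_inverse matrix_left_invertible_ker
proof (intro allI impI)
  fix u assume y: "y \<in> W" and "G y *v u = 0"
  then have "bil (G y) u v = 0" for v using sym[OF y, of u v] by (simp add: bil_def)
  then show "u = 0" by (rule nondeg[OF y])
qed

lemma bil_eqI:
  assumes "y \<in> W" "\<And>w. bil (G y) a w = bil (G y) b w"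
  shows "a = b"
  using nondeg[of y "a - b"] assms by (simp add: bil_diff)

lemma smooth_bil_G: "smooth_on W (\<lambda>y. bil (G y) u v)"
  by (rule smooth_on_linear[OF open_W _ smooth_G])
    (simp add: linear_bil_matrix linear_conv_bounded_linear[symmetric])

lemma pder_bil_G: "y \<in> W \<Longrightarrow> \<partial> (\<lambda>z. bil (G z) u v) y w = bil (\<partial> G y w) u v"
  by (rule pder_linear[OF _ smooth_G])
    (simp_all add: linear_bil_matrix linear_conv_bounded_linear[symmetric])

lemma pder_G_sym: "y \<in> W \<Longrightarrow> bil (\<partial> G y w) u v = bil (\<partial> G y w) v u"
  unfolding pder_bil_G[symmetric] by (rule pder_cong_open[OF open_W]) (auto intro: sym)

lemma linear_pder_G: "y \<in> W \<Longrightarrow> linear (\<lambda>w. bil (\<partial> G y w) u v)"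
  using linear_compose[OF linear_pder[OF smooth_G, of y] linear_bil_matrix[of u v]]
  by (simp add: o_def)

text \<open>Both sides are linear in \<open>w\<close>, and on coordinate vectors the equation is the definition of the
  Christoffel symbols.\<close>

lemma Koszul:
  assumes y: "y \<in> W"
  shows "bil (G y) (Christoffel G y u v) w =
    (bil (\<partial> G y u) v w + bil (\<partial> G y v) u w - bil (\<partial> G y w) u v) / 2"
proof -
  let ?r = "\<lambda>w. (bil (\<partial> G y u) v w + bil (\<partial> G y v) u w - bil (\<partial> G y w) u v) / 2"
  have lin: "linear ?r"
    by (rule linearI) (simp_all add: bil_add bil_scaleR linear_add[OF linear_pder_G[OF y]]
        linear_cmul[OF linear_pder_G[OF y]] algebra_simps add_divide_distrib diff_divide_distrib)
  have "bil (G y) (Christoffel G y u v) w = bil (G y) w (Christoffel G y u v)" by (rule sym[OF y])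
  also have "\<dots> = w \<bullet> (\<chi> l. ?r (axis l 1))"
    unfolding Christoffel_def pder_bil_G[OF y]
    by (simp only: bil_def[of "G y" w] matrix_inv_mult(2)[OF invertible_G[OF y]])
  also have "\<dots> = ?r w"
    unfolding linear_axis_expansion[OF lin, of w] by (simp add: inner_vec_def)
  finally show ?thesis .
qed

lemma Christoffel_sym: "y \<in> W \<Longrightarrow> Christoffel G y u v = Christoffel G y v u"
  by (rule bil_eqI) (auto simp: Koszul pder_G_sym[of y _ u v])

lemma linear_Christoffel_right: "y \<in> W \<Longrightarrow> linear (Christoffel G y u)"
  by (rule linearI; rule bil_eqI[of y])
    (simp_all add: Koszul bil_add bil_scaleR linear_add[OF linear_pder_G]
        linear_cmul[OF linear_pder_G] algebra_simps add_divide_distrib diff_divide_distrib)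

lemma linear_Christoffel_left: "y \<in> W \<Longrightarrow> linear (\<lambda>u. Christoffel G y u v)"
  using linear_Christoffel_right[of y v] by (simp add: Christoffel_sym[of y _ v])

lemma smooth_Christoffel: "smooth_on W (\<lambda>y. Christoffel G y u v)"
proof -
  have "smooth_on W (\<lambda>y. \<chi> l. (1/2) *\<^sub>R (\<partial> (\<lambda>z. bil (G z) v (axis l 1)) y u
      + \<partial> (\<lambda>z. bil (G z) u (axis l 1)) y v - \<partial> (\<lambda>z. bil (G z) u v) y (axis l 1)))"
    by (intro smooth_on_vec smooth_on_scaleR smooth_on_add smooth_on_diff smooth_on_pder
        smooth_bil_G open_W smooth_on_const)
  from smooth_on_matrix_inv[OF open_W smooth_G invertible_G this]
  show ?thesis by (simp add: Christoffel_def)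
qed

text \<open>The Christoffel symbols are compatible with the metric: the terms of the Koszul formula that
  are not symmetric in \<open>v\<close> and \<open>w\<close> cancel.\<close>

lemma pder_G_Christoffel:
  "y \<in> W \<Longrightarrow> bil (\<partial> G y u) v w = bil (G y) (Christoffel G y u v) w + bil (G y) v (Christoffel G y u w)"
  by (simp add: sym[of y v] Koszul pder_G_sym[of y _ w v] field_simps)

end

locale map_into_metric_region = metric_region W G
  for W :: "(real^'k::finite) set" and G :: "real^'k \<Rightarrow> real^'k^'k" +
  fixes \<Omega> :: "(real^'n::finite) set" and F :: "real^'n \<Rightarrow> real^'k"
  assumes open_\<Omega>: "open \<Omega>" and smooth_F: "smooth_on \<Omega> F" and maps: "x \<in> \<Omega> \<Longrightarrow> F x \<in> W"
begin

lemma linear_pder_F: "x \<in> \<Omega> \<Longrightarrow> linear (\<partial> F x)"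
  by (rule linear_pder[OF smooth_F])

lemma smooth_bil:
  assumes "smooth_on \<Omega> U" "smooth_on \<Omega> V"
  shows "smooth_on \<Omega> (\<lambda>x. bil (G (F x)) (U x) (V x))"
  by (rule smooth_on_bilinear_family[OF open_\<Omega>, where B = "\<lambda>x. bil (G (F x))"])
    (rule linear_bil_left linear_bil_right assms smooth_on_compose[OF open_\<Omega> smooth_F smooth_bil_G]
      | rule maps, assumption)+

lemma smooth_Christoffel_F:
  assumes "smooth_on \<Omega> U" "smooth_on \<Omega> V"
  shows "smooth_on \<Omega> (\<lambda>x. Christoffel G (F x) (U x) (V x))"
  by (rule smooth_on_bilinear_family[OF open_\<Omega>, where B = "\<lambda>x. Christoffel G (F x)"])
    (auto intro: assms smooth_on_compose[OF open_\<Omega> smooth_F smooth_Christoffel] maps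
      linear_Christoffel_left linear_Christoffel_right)

lemma pder_Christoffel_F:
  assumes "smooth_on \<Omega> U" "smooth_on \<Omega> V" and x: "x \<in> \<Omega>"
  shows "\<partial> (\<lambda>q. Christoffel G (F q) (U q) (V q)) x h = \<partial> (\<lambda>y. Christoffel G y (U x) (V x)) (F x) (\<partial> F x h)
    + Christoffel G (F x) (\<partial> U x h) (V x) + Christoffel G (F x) (U x) (\<partial> V x h)"
proof -
  have "\<partial> (\<lambda>q. Christoffel G (F q) (U q) (V q)) x h = \<partial> (\<lambda>q. Christoffel G (F q) (U x) (V x)) x h
    + Christoffel G (F x) (\<partial> U x h) (V x) + Christoffel G (F x) (U x) (\<partial> V x h)"
    by (rule pder_bilinear_family[OF open_\<Omega>, where B = "\<lambda>x. Christoffel G (F x)"])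
      (auto intro: assms smooth_on_compose[OF open_\<Omega> smooth_F smooth_Christoffel] maps
        linear_Christoffel_left linear_Christoffel_right)
  also have "\<partial> (\<lambda>q. Christoffel G (F q) (U x) (V x)) x h = \<partial> (\<lambda>y. Christoffel G y (U x) (V x)) (F x) (\<partial> F x h)"
    by (rule pder_compose[OF smooth_F smooth_Christoffel x maps[OF x]])
  finally show ?thesis .
qed

lemma smooth_cov: "smooth_on \<Omega> V \<Longrightarrow> smooth_on \<Omega> (\<lambda>x. cov G F V x h)"
  unfolding cov_def by (intro smooth_on_add smooth_Christoffel_F smooth_on_pder smooth_F open_\<Omega>)

lemma linear_cov:
  assumes "smooth_on \<Omega> V" "x \<in> \<Omega>"
  shows "linear (cov G F V x)"
  using linear_compose_add[OF linear_pder[OF assms]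
      linear_compose[OF linear_pder_F[OF assms(2)] linear_Christoffel_left[OF maps[OF assms(2)], of "V x"]]]
  by (simp add: cov_def[abs_def] o_def)

lemma cov_scaleR:
  assumes "smooth_on \<Omega> h" "smooth_on \<Omega> V" "x \<in> \<Omega>"
  shows "cov G F (\<lambda>q. h q *\<^sub>R V q) x u = \<partial> h x u *\<^sub>R V x + h x *\<^sub>R cov G F V x u"
  by (simp add: cov_def pder_scaleR[OF assms] linear_cmul[OF linear_Christoffel_right[OF maps[OF assms(3)]]]
      scaleR_add_right)

lemma cov_add:
  assumes "smooth_on \<Omega> U" "smooth_on \<Omega> V" "x \<in> \<Omega>"
  shows "cov G F (\<lambda>q. U q + V q) x u = cov G F U x u + cov G F V x u"
  by (simp add: cov_def pder_add[OF assms] linear_add[OF linear_Christoffel_right[OF maps[OF assms(3)]]])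

text \<open>For a frame field \<open>Y\<close> this isolates the derivative of the frame in a first-order term, which the
  correction term of the Laplacian cancels.\<close>

lemma cov_cov_field:
  assumes V: "smooth_on \<Omega> V" and Y: "smooth_on \<Omega>' Y" "open \<Omega>'" "\<Omega>' \<subseteq> \<Omega>" and x: "x \<in> \<Omega>'"
  shows "cov G F (\<lambda>q. cov G F V q (Y q)) x h = cov G F (\<lambda>q. cov G F V q (Y x)) x h + cov G F V x (\<partial> Y x h)"
proof -
  have "\<partial> (\<lambda>q. cov G F V q (Y q)) x h = \<partial> (\<lambda>q. cov G F V q (Y x)) x h + cov G F V x (\<partial> Y x h)"
    by (rule pder_linear_family[OF Y(2), where L = "cov G F V"])
      (use Y(3) in \<open>auto intro: linear_cov[OF V] smooth_on_subset[OF smooth_cov[OF V]] Y x\<close>)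
  then show ?thesis
    by (simp add: cov_def[of G F "\<lambda>q. cov G F V q (Y q)"] cov_def[of G F "\<lambda>q. cov G F V q (Y x)"])
qed

lemma pder_bil:
  assumes U: "smooth_on \<Omega> U" and V: "smooth_on \<Omega> V" and x: "x \<in> \<Omega>"
  shows "\<partial> (\<lambda>q. bil (G (F q)) (U q) (V q)) x h =
    bil (G (F x)) (cov G F U x h) (V x) + bil (G (F x)) (U x) (cov G F V x h)"
proof -
  have "\<partial> (\<lambda>q. bil (G (F q)) (U q) (V q)) x h = \<partial> (\<lambda>q. bil (G (F q)) (U x) (V x)) x h
    + bil (G (F x)) (\<partial> U x h) (V x) + bil (G (F x)) (U x) (\<partial> V x h)"
    by (rule pder_bilinear_family[OF open_\<Omega>, where B = "\<lambda>x. bil (G (F x))"])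
      (rule linear_bil_left linear_bil_right U V x smooth_on_compose[OF open_\<Omega> smooth_F smooth_bil_G]
        | rule maps, assumption)+
  also have "\<partial> (\<lambda>q. bil (G (F q)) (U x) (V x)) x h = \<partial> (\<lambda>y. bil (G y) (U x) (V x)) (F x) (\<partial> F x h)"
    by (rule pder_compose[OF smooth_F smooth_bil_G x maps[OF x]])
  finally show ?thesis
    by (simp add: pder_bil_G[OF maps[OF x]] pder_G_Christoffel[OF maps[OF x]] cov_def bil_add)
qed

text \<open>Vanishing torsion: second derivatives of \<open>F\<close> commute and Christoffel symbols are symmetric.\<close>

lemma cov_pder_commute:
  assumes x: "x \<in> \<Omega>"
  shows "cov G F (\<lambda>q. \<partial> F q v) x u = cov G F (\<lambda>q. \<partial> F q u) x v"
  unfolding cov_def second_pder_commute[OF open_\<Omega> smooth_F x, of v u]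
    Christoffel_sym[OF maps[OF x], of "\<partial> F x u"] ..

lemma riem_formula:
  assumes y: "y \<in> W"
  shows "riem G y u v w = \<partial> (\<lambda>z. Christoffel G z v w) y u - \<partial> (\<lambda>z. Christoffel G z u w) y v
    + Christoffel G y u (Christoffel G y v w) - Christoffel G y v (Christoffel G y u w)"
  by (simp add: riem_def cov_def)

text \<open>In the difference, the second derivatives of \<open>V\<close> and of \<open>F\<close> cancel, and so do the products of
  Christoffel symbols with first derivatives of \<open>V\<close>; by the chain rule the rest is the curvature of
  the ambient metric on the images of \<open>u\<close> and \<open>v\<close>.\<close>

lemma cov_commutator:
  assumes V: "smooth_on \<Omega> V" and x: "x \<in> \<Omega>"
  shows "cov G F (\<lambda>q. cov G F V q v) x u - cov G F (\<lambda>q. cov G F V q u) x v =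
    riem G (F x) (\<partial> F x u) (\<partial> F x v) (V x)"
proof -
  have *: "\<partial> (\<lambda>q. cov G F V q v) x u = \<partial> (\<lambda>q. \<partial> V q v) x u +
    (\<partial> (\<lambda>y. Christoffel G y (\<partial> F x v) (V x)) (F x) (\<partial> F x u)
      + Christoffel G (F x) (\<partial> (\<lambda>q. \<partial> F q v) x u) (V x) + Christoffel G (F x) (\<partial> F x v) (\<partial> V x u))" for u v
    unfolding cov_def
    by (subst pder_add[OF smooth_on_pder[OF V] smooth_Christoffel_F[OF smooth_on_pder[OF smooth_F] V] x])
      (simp add: pder_Christoffel_F[OF smooth_on_pder[OF smooth_F] V x])
  have "cov G F (\<lambda>q. cov G F V q v) x u = \<partial> (\<lambda>q. \<partial> V q v) x u +
    (\<partial> (\<lambda>y. Christoffel G y (\<partial> F x v) (V x)) (F x) (\<partial> F x u)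
      + Christoffel G (F x) (\<partial> (\<lambda>q. \<partial> F q v) x u) (V x) + Christoffel G (F x) (\<partial> F x v) (\<partial> V x u))
    + Christoffel G (F x) (\<partial> F x u) (\<partial> V x v) + Christoffel G (F x) (\<partial> F x u) (Christoffel G (F x) (\<partial> F x v) (V x))" for u v
    unfolding cov_def[of G F "\<lambda>q. cov G F V q v"] *
    by (simp add: cov_def linear_add[OF linear_Christoffel_right[OF maps[OF x]]])
  then show ?thesis
    using second_pder_commute[OF open_\<Omega> V x, of v u]
      second_pder_commute[OF open_\<Omega> smooth_F x, of v u]
    by (simp add: riem_formula[OF maps[OF x]])
qed

end

sublocale metric_region \<subseteq> self: map_into_metric_region W G W id
  by unfold_locales (auto simp: open_W)

context metric_region
begin

lemma riem_antisym: "riem G y v u w = - riem G y u v w"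
  by (simp add: riem_def)

text \<open>Linearity in the first argument suffices: the symmetries of the curvature tensor transport it to the
  other ones.\<close>

lemma linear_riem: "y \<in> W \<Longrightarrow> linear (\<lambda>u. riem G y u v w)"
proof -
  assume y: "y \<in> W"
  have l: "linear (\<partial> (\<lambda>z. Christoffel G z v w) y)" by (rule linear_pder[OF smooth_Christoffel y])
  have "\<partial> (\<lambda>z. Christoffel G z (a + b) w) y v = \<partial> (\<lambda>z. Christoffel G z a w) y v + \<partial> (\<lambda>z. Christoffel G z b w) y v" for a b
    unfolding pder_add[OF smooth_Christoffel smooth_Christoffel y, symmetric]
    by (rule pder_cong_open[OF open_W y]) (rule linear_add[OF linear_Christoffel_left])
  moreover have "\<partial> (\<lambda>z. Christoffel G z (r *\<^sub>R a) w) y v = r *\<^sub>R \<partial> (\<lambda>z. Christoffel G z a w) y v" for r a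
    unfolding pder_linear[OF bounded_linear_scaleR_right smooth_Christoffel y, symmetric]
    by (rule pder_cong_open[OF open_W y]) (rule linear_cmul[OF linear_Christoffel_left])
  ultimately show ?thesis
    by (intro linearI) (simp_all add: self.riem_formula[OF y] linear_add[OF l] linear_cmul[OF l]
        linear_add[OF linear_Christoffel_left[OF y]] linear_add[OF linear_Christoffel_right[OF y]]
        linear_cmul[OF linear_Christoffel_left[OF y]] linear_cmul[OF linear_Christoffel_right[OF y]] algebra_simps)
qed

lemma riem_Bianchi:
  "y \<in> W \<Longrightarrow> riem G y u v w + riem G y v w u + riem G y w u v = 0"
proof -
  assume y: "y \<in> W"
  have "\<partial> (\<lambda>z. Christoffel G z a b) y c = \<partial> (\<lambda>z. Christoffel G z b a) y c" for a b c
    by (rule pder_cong_open[OF open_W y]) (rule Christoffel_sym)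
  then show ?thesis
    by (simp add: self.riem_formula[OF y] Christoffel_sym[OF y, of w v] Christoffel_sym[OF y, of w u] Christoffel_sym[OF y, of v u])
qed

text \<open>Differentiate the inner product of the constant fields \<open>w\<close>, \<open>z\<close> twice by metric compatibility. The
  result is symmetric in the two directions, as are the terms with one derivative on each field;
  antisymmetrizing the remaining ones leaves the curvature acting on \<open>w\<close> and on \<open>z\<close>.\<close>

lemma riem_skew:
  assumes y: "y \<in> W"
  shows "bil (G y) (riem G y u v w) z = - bil (G y) (riem G y u v z) w"
proof -
  note c = smooth_on_const
  note sc = self.smooth_cov
  have s: "smooth_on W (\<lambda>q. bil (G q) w z)" by (rule smooth_bil_G)
  have 1: "\<partial> (\<lambda>q. \<partial> (\<lambda>q. bil (G q) w z) q v) y u =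
      bil (G y) (cov G id (\<lambda>q. cov G id (\<lambda>_. w) q v) y u) z + bil (G y) (cov G id (\<lambda>_. w) y v) (cov G id (\<lambda>_. z) y u)
    + (bil (G y) (cov G id (\<lambda>_. w) y u) (cov G id (\<lambda>_. z) y v) + bil (G y) w (cov G id (\<lambda>q. cov G id (\<lambda>_. z) q v) y u))"
    for u v
  proof -
    have "\<partial> (\<lambda>q. \<partial> (\<lambda>q. bil (G q) w z) q v) y u =
        \<partial> (\<lambda>q. bil (G q) (cov G id (\<lambda>_. w) q v) z + bil (G q) w (cov G id (\<lambda>_. z) q v)) y u"
      by (rule pder_cong_open[OF open_W y]) (use self.pder_bil[OF c c] in simp)
    also have "\<dots> = \<partial> (\<lambda>q. bil (G q) (cov G id (\<lambda>_. w) q v) z) y u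
        + \<partial> (\<lambda>q. bil (G q) w (cov G id (\<lambda>_. z) q v)) y u"
      using self.smooth_bil[OF sc[OF c] c] self.smooth_bil[OF c sc[OF c]]
      by (intro pder_add[OF _ _ y]) simp_all
    finally show ?thesis
      using self.pder_bil[OF sc[OF c] c y] self.pder_bil[OF c sc[OF c] y] by simp
  qed
  show ?thesis
    using second_pder_commute[OF open_W s y, of v u] unfolding 1
    by (simp add: riem_def bil_diff sym[OF y, of w] sym[OF y, of "cov G id (\<lambda>_. w) y u"])
qed

end

section \<open>Constant sectional curvature\<close>

text \<open>The first two Bianchi sums minus the last two, after sorting the arguments by antisymmetry.\<close>

lemma curvature_like_pair:
  fixes S :: "'a \<Rightarrow> 'a \<Rightarrow> 'a \<Rightarrow> 'a \<Rightarrow> real"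
  assumes a12: "\<And>u v w z. S v u w z = - S u v w z"
    and a34: "\<And>u v w z. S u v z w = - S u v w z"
    and bianchi: "\<And>u v w z. S u v w z + S v w u z + S w u v z = 0"
  shows "S u v w z = S w z u v"
  using bianchi[of u v w z] bianchi[of v w z u] bianchi[of w z u v] bianchi[of z u v w]
    a34[of v w u z] a34[of w z u v] a12[of v z w u] a34[of v z u w] a12[of w u z v] a34[of w u v z]
    a34[of z u w v] a34[of u v w z]
  by linarith

text \<open>A tensor with the symmetries of a curvature tensor is determined by its sectional values: polarizing
  the vanishing of \<open>S u v v u\<close> in \<open>v\<close> and then in \<open>u\<close> makes \<open>S\<close> alternate in its outer arguments as well,
  hence invariant under cyclic permutations of the first three, and the Bianchi sum becomes \<open>3 S\<close>.\<close>

lemma curvature_like_zero: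
  fixes S :: "'a::real_vector \<Rightarrow> 'a \<Rightarrow> 'a \<Rightarrow> 'a \<Rightarrow> real"
  assumes lin: "\<And>v w z. linear (\<lambda>u. S u v w z)"
    and a12: "\<And>u v w z. S v u w z = - S u v w z"
    and a34: "\<And>u v w z. S u v z w = - S u v w z"
    and bianchi: "\<And>u v w z. S u v w z + S v w u z + S w u v z = 0"
    and zero: "\<And>u v. S u v v u = 0"
  shows "S u v w z = 0"
proof -
  have pair: "S u v w z = S w z u v" for u v w z
    by (rule curvature_like_pair) (fact a12 a34 bianchi)+
  have add1: "S (u + u') v w z = S u v w z + S u' v w z" for u u' v w z
    by (rule linear_add[OF lin])
  have add2: "S u (v + v') w z = S u v w z + S u v' w z" for u v v' w z
    using add1[of v v' u w z] a12[of u "v + v'" w z] a12[of u v w z] a12[of u v' w z] by simp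
  have add3: "S u v (w + w') z = S u v w z + S u v w' z" for u v w w' z
    unfolding pair[of u v _ z] by (rule add1)
  have add4: "S u v w (z + z') = S u v w z + S u v w z'" for u v w z z'
    unfolding pair[of u v w] by (rule add2)
  have s1: "S u v w u = 0" for u v w
    using zero[of u "v + w"] zero[of u v] zero[of u w] pair[of u v w u] a12[of u w u v] a34[of u w v u]
    by (simp add: add2 add3)
  have s2: "S u v w z = - S z v w u" for u v w z
    using s1[of "u + z" v w] s1[of u v w] s1[of z v w] by (simp add: add1 add4)
  have "S u v w z = S v w u z" for u v w z
    using s2[of u v w z] pair[of z v w u] a12[of w u z v] s2[of u w z v] a34[of v w z u] by linarith
  from this[of u v w z] this[of v w u z] show ?thesis using bianchi[of u v w z] by linarith
qed

text \<open>A quadratic form vanishes if it does so off the zero set of another, nonzero one: along the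
  line through \<open>u\<close> in direction \<open>a\<close> both are polynomials, their product vanishes identically, and the
  second factor is not the zero polynomial.\<close>

lemma quadratic_form_zero:
  fixes s q :: "'a::real_vector \<Rightarrow> real"
  assumes s: "\<And>t. s (u + t *\<^sub>R a) = s u + t * s1 + t\<^sup>2 * s a"
    and q: "\<And>t. q (u + t *\<^sub>R a) = q u + t * q1 + t\<^sup>2 * q a"
    and nz: "q a \<noteq> 0" and z: "\<And>u. q u \<noteq> 0 \<Longrightarrow> s u = 0"
  shows "s u = 0"
proof -
  let ?s = "[:s u, s1, s a:]" and ?q = "[:q u, q1, q a:]"
  have "poly ?s t = s (u + t *\<^sub>R a)" "poly ?q t = q (u + t *\<^sub>R a)" for t
    by (simp_all add: s q power2_eq_square algebra_simps)
  then have "poly (?s * ?q) t = 0" for t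
    using z[of "u + t *\<^sub>R a"] by (simp only: poly_mult) auto
  then have "?s * ?q = 0" using poly_all_0_iff_0 by blast
  then have "?s = 0 \<or> ?q = 0" by (simp only: mult_eq_0_iff)
  then show ?thesis using nz by simp
qed

text \<open>The sectional curvature is prescribed on nondegenerate planes only. The difference \<open>S\<close> between \<open>R\<close> and
  the model tensor therefore vanishes on these planes, and with one such plane, spanned by \<open>a\<close> and \<open>b\<close>,
  \<open>quadratic_form_zero\<close> removes the restriction, first in one argument and then in the other.\<close>

lemma curvature_like_constant:
  fixes R :: "'a::real_vector \<Rightarrow> 'a \<Rightarrow> 'a \<Rightarrow> 'a \<Rightarrow> real" and g :: "'a \<Rightarrow> 'a \<Rightarrow> real"
  assumes lin: "\<And>v w z. linear (\<lambda>u. R u v w z)"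
    and a12: "\<And>u v w z. R v u w z = - R u v w z"
    and a34: "\<And>u v w z. R u v z w = - R u v w z"
    and bianchi: "\<And>u v w z. R u v w z + R v w u z + R w u v z = 0"
    and g: "\<And>v. linear (\<lambda>u. g u v)" "\<And>u v. g u v = g v u"
    and sec: "\<And>u v. g u u * g v v - (g u v)\<^sup>2 \<noteq> 0 \<Longrightarrow>
      R u v v u = \<kappa> * (g u u * g v v - (g u v)\<^sup>2)"
    and nd: "g a a * g b b - (g a b)\<^sup>2 \<noteq> 0"
  shows "R u v w z = \<kappa> * (g v w * g u z - g u w * g v z)"
proof -
  define S where "S u v w z = R u v w z - \<kappa> * (g v w * g u z - g u w * g v z)" for u v w z
  define Q where "Q u v = g u u * g v v - (g u v)\<^sup>2" for u v
  note ga = linear_add[OF g(1)] and gc = linear_cmul[OF g(1)]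
  have ga': "g v (u + u') = g v u + g v u'" for v u u' 
    using ga[of u u' v] g(2)[of v "u + u'"] g(2)[of v u] g(2)[of v u'] by linarith
  have gc': "g v (r *\<^sub>R u) = r * g v u" for v u r 
    using gc[of r u v] g(2)[of v "r *\<^sub>R u"] g(2)[of v u] by simp
  have lS: "linear (\<lambda>u. S u v w z)" for v w z
    by (rule linearI) (simp_all add: S_def linear_add[OF lin] linear_cmul[OF lin] ga gc algebra_simps)
  have S12: "S v u w z = - S u v w z" for u v w z
    using a12[of u v w z] by (simp add: S_def algebra_simps)
  have S34: "S u v z w = - S u v w z" for u v w z
    using a34[of u v w z] by (simp add: S_def algebra_simps)
  have SB: "S u v w z + S v w u z + S w u v z = 0" for u v w z
    using bianchi[of u v w z] g(2)[of u v] g(2)[of u w] g(2)[of v w] by (simp add: S_def algebra_simps)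
  have add1: "S (u + u') v w z = S u v w z + S u' v w z" and c1: "S (r *\<^sub>R u) v w z = r * S u v w z" for r u u' v w z
    using linear_add[OF lS] linear_cmul[OF lS] by auto
  have add2: "S u (v + v') w z = S u v w z + S u v' w z" for u v v' w z
    using add1[of v v' u w z] S12[of u "v + v'"] S12[of u v] S12[of u v'] by simp
  have c2: "S u (r *\<^sub>R v) w z = r * S u v w z" for r u v w z
    using c1[of r v u w z] S12[of u "r *\<^sub>R v"] S12[of u v] by simp
  have pair: "S u v w z = S w z u v" for u v w z
    by (rule curvature_like_pair) (fact S12 S34 SB)+
  have add3: "S u v (w + w') z = S u v w z + S u v w' z" for u v w w' z
    unfolding pair[of u v _ z] by (rule add1)
  have c3: "S u v (r *\<^sub>R w) z = r * S u v w z" for r u v w z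
    unfolding pair[of u v _ z] by (rule c1)
  have add4: "S u v w (z + z') = S u v w z + S u v w z'" for u v w z z'
    unfolding pair[of u v w] by (rule add2)
  have c4: "S u v w (r *\<^sub>R z) = r * S u v w z" for r u v w z
    unfolding pair[of u v w] by (rule c2)
  have z: "S u v v u = 0" if "Q u v \<noteq> 0" for u v
    using sec[of u v] that g(2)[of v u] by (simp add: S_def Q_def power2_eq_square algebra_simps)
  \<comment> \<open>\<open>v\<close> is fixed, and \<open>Q _ v\<close> is a quadratic form which does not vanish at \<open>a\<close>.\<close>
  have z1: "S u v v u = 0" if "Q a v \<noteq> 0" for u v
  proof (rule quadratic_form_zero[where a = a and q = "\<lambda>u. Q u v" and s = "\<lambda>u. S u v v u"
        and ?s1.0 = "S u v v a + S a v v u" and ?q1.0 = "2 * (g u a * g v v - g u v * g a v)"])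
    show "S (u + t *\<^sub>R a) v v (u + t *\<^sub>R a) = S u v v u + t * (S u v v a + S a v v u) + t\<^sup>2 * S a v v a" for t
      by (simp add: add1 add4 c1 c4 power2_eq_square algebra_simps)
    show "Q (u + t *\<^sub>R a) v = Q u v + t * (2 * (g u a * g v v - g u v * g a v)) + t\<^sup>2 * Q a v" for t
      using g(2)[of a u] by (simp add: Q_def ga ga' gc gc' power2_eq_square algebra_simps)
  qed (use that z in auto)
  \<comment> \<open>Now \<open>u\<close> is fixed, and the form \<open>Q a\<close> does not vanish at \<open>b\<close>.\<close>
  have "S u v v u = 0" for u v
  proof (rule quadratic_form_zero[where a = b and q = "\<lambda>v. Q a v" and s = "\<lambda>v. S u v v u"
        and ?s1.0 = "S u v b u + S u b v u" and ?q1.0 = "2 * (g v b * g a a - g a v * g a b)"])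
    show "S u (v + t *\<^sub>R b) (v + t *\<^sub>R b) u = S u v v u + t * (S u v b u + S u b v u) + t\<^sup>2 * S u b b u" for t
      by (simp add: add2 add3 c2 c3 power2_eq_square algebra_simps)
    show "Q a (v + t *\<^sub>R b) = Q a v + t * (2 * (g v b * g a a - g a v * g a b)) + t\<^sup>2 * Q a b" for t
      using g(2)[of b v] by (simp add: Q_def ga ga' gc gc' power2_eq_square algebra_simps)
  qed (use nd z1 in \<open>auto simp: Q_def\<close>)
  from curvature_like_zero[OF lS S12 S34 SB this]
  show ?thesis by (simp add: S_def)
qed

lemma (in metric_region) riem_constant:
  assumes y: "y \<in> W"
    and sec: "\<And>u v. bil (G y) u u * bil (G y) v v - (bil (G y) u v)\<^sup>2 \<noteq> 0 \<Longrightarrow>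
      bil (G y) (riem G y u v v) u = \<kappa> * (bil (G y) u u * bil (G y) v v - (bil (G y) u v)\<^sup>2)"
    and nd: "bil (G y) a a * bil (G y) b b - (bil (G y) a b)\<^sup>2 \<noteq> 0"
  shows "bil (G y) (riem G y u v w) z =
    \<kappa> * (bil (G y) v w * bil (G y) u z - bil (G y) u w * bil (G y) v z)"
proof (rule curvature_like_constant[where R = "\<lambda>u v w z. bil (G y) (riem G y u v w) z"
      and g = "bil (G y)" and a = a and b = b])
  show "linear (\<lambda>u. bil (G y) (riem G y u v w) z)" for v w z
    using linear_compose[OF linear_riem[OF y] linear_bil_left] by (simp add: o_def)
  show "bil (G y) (riem G y v u w) z = - bil (G y) (riem G y u v w) z" for u v w z
    unfolding riem_antisym[of y v u] by (rule bil_minus)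
  show "bil (G y) (riem G y u v z) w = - bil (G y) (riem G y u v w) z" for u v w z
    by (rule riem_skew[OF y])
  show "bil (G y) (riem G y u v w) z + bil (G y) (riem G y v w u) z + bil (G y) (riem G y w u v) z = 0"
    for u v w z
    using riem_Bianchi[OF y, of u v w] by (simp add: bil_add(1)[symmetric] bil_zero)
qed (fact linear_bil_left sym[OF y] sec nd)+

section \<open>Hypersurfaces in coordinates\<close>

definition orthonormal_frame :: "real^'n^'n \<Rightarrow> ('n \<Rightarrow> real) \<Rightarrow> ('n \<Rightarrow> real^'n) \<Rightarrow> bool" where
  "orthonormal_frame M \<sigma> e \<longleftrightarrow>
     (\<forall>i. \<sigma> i \<in> {1, -1}) \<and> (\<forall>i j. bil M (e i) (e j) = (if i = j then \<sigma> i else 0))"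

text \<open>The matrix with columns \<open>e i\<close> is inverted by the one with rows \<open>\<sigma> i * bil M (e i) _\<close>; a left inverse of a
  square matrix is a right inverse.\<close>

lemma
  assumes "orthonormal_frame M \<sigma> e"
  shows orthonormal_frame_expansion: "(\<Sum>i\<in>UNIV. (\<sigma> i * bil M (e i) v) *\<^sub>R e i) = v"
    and orthonormal_frame_trace: "(\<Sum>i\<in>UNIV. \<sigma> i * bil M (e i) (L *v e i)) = trace L"
proof -
  define E where "E = (\<chi> i j. e j $ i)"
  define D where "D = (\<chi> i. \<sigma> i *\<^sub>R (e i v* M))"
  have D: "(D *v v) $ i = \<sigma> i * bil M (e i) v" for v i
    by (simp add: D_def matrix_vector_mul_component bil_def dot_lmul_matrix)
  have E: "E *v w = (\<Sum>i\<in>UNIV. (w $ i) *\<^sub>R e i)" for w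
    by (simp add: E_def vec_eq_iff matrix_vector_mult_def mult.commute)
  have col: "(X ** Y) $ i $ j = (X *v (\<chi> k. Y $ k $ j)) $ i" for X Y :: "real^'n^'n" and i j
    by (simp add: matrix_matrix_mult_def matrix_vector_mult_def)
  have ej: "(\<chi> k. E $ k $ j) = e j" for j by (simp add: E_def vec_eq_iff)
  have "D ** E = mat 1"
    using assms unfolding orthonormal_frame_def
    by (simp add: vec_eq_iff col ej D mat_def) (metis insertE mult_minus_left mult.right_neutral
        minus_minus mult_1 singletonD)
  then have ED: "E ** D = mat 1" by (simp add: matrix_left_right_inverse)
  have "E *v (D *v v) = v" by (simp add: matrix_vector_mul_assoc ED)
  then show "(\<Sum>i\<in>UNIV. (\<sigma> i * bil M (e i) v) *\<^sub>R e i) = v" by (simp add: E D)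
  have "trace L = trace ((L ** E) ** D)" by (simp add: matrix_mul_assoc[symmetric] ED)
  also have "\<dots> = trace (D ** (L ** E))" by (rule trace_mul_sym)
  also have "\<dots> = (\<Sum>i\<in>UNIV. \<sigma> i * bil M (e i) (L *v e i))"
  proof -
    have "(\<chi> k. (L ** E) $ k $ i) = L *v e i" for i
      by (simp add: vec_eq_iff col ej)
    then show ?thesis by (simp add: trace_def col[of D] D)
  qed
  finally show "(\<Sum>i\<in>UNIV. \<sigma> i * bil M (e i) (L *v e i)) = trace L" ..
qed

locale hypersurface_patch = map_into_metric_region W G \<Omega> F
  for W :: "(real^'k::finite) set" and G :: "real^'k \<Rightarrow> real^'k^'k"
    and \<Omega> :: "(real^'n::finite) set" and F :: "real^'n \<Rightarrow> real^'k" +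
  fixes g :: "real^'n \<Rightarrow> real^'n^'n" and \<xi> :: "real^'n \<Rightarrow> real^'k"
    and A :: "real^'n \<Rightarrow> real^'n^'n" and \<epsilon> :: real
  assumes smooth_g: "smooth_on \<Omega> g"
    and induced: "x \<in> \<Omega> \<Longrightarrow> bil (g x) u v = bil (G (F x)) (\<partial> F x u) (\<partial> F x v)"
    and nondeg_g: "x \<in> \<Omega> \<Longrightarrow> (\<And>v. bil (g x) u v = 0) \<Longrightarrow> u = 0"
    and \<epsilon>: "\<epsilon> = 1 \<or> \<epsilon> = -1"
    and smooth_\<xi>: "smooth_on \<Omega> \<xi>"
    and unit: "x \<in> \<Omega> \<Longrightarrow> bil (G (F x)) (\<xi> x) (\<xi> x) = \<epsilon>"
    and normal: "x \<in> \<Omega> \<Longrightarrow> bil (G (F x)) (\<xi> x) (\<partial> F x u) = 0"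
    and weingarten: "x \<in> \<Omega> \<Longrightarrow> cov G F \<xi> x u = - \<partial> F x (A x *v u)"
    and riem_normal: "x \<in> \<Omega> \<Longrightarrow>
      bil (G (F x)) (riem G (F x) (\<partial> F x u) (\<partial> F x v) (\<xi> x)) (\<partial> F x z) = 0"

sublocale hypersurface_patch \<subseteq> ind: metric_region \<Omega> g
proof
  show "bil (g x) u v = bil (g x) v u" if "x \<in> \<Omega>" for x u v
    using sym[OF maps[OF that]] by (simp add: induced[OF that])
qed (fact open_\<Omega> smooth_g nondeg_g)+

context hypersurface_patch
begin

abbreviation amb :: "real^'n \<Rightarrow> real^'k \<Rightarrow> real^'k \<Rightarrow> real" where "amb x \<equiv> bil (G (F x))"

lemma amb_sym: "x \<in> \<Omega> \<Longrightarrow> amb x u v = amb x v u"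
  by (rule sym[OF maps])

lemma normal': "x \<in> \<Omega> \<Longrightarrow> amb x (\<partial> F x u) (\<xi> x) = 0"
  using normal amb_sym by metis

lemma smooth_pder_F: "smooth_on \<Omega> (\<lambda>q. \<partial> F q v)"
  by (rule smooth_on_pder[OF smooth_F])

text \<open>Gauss formula: the Levi-Civita connection of the induced metric is the tangential part of the
  ambient one, since both are determined by the derivatives of the induced metric.\<close>

lemma gauss:
  assumes x: "x \<in> \<Omega>"
  shows "amb x (cov G F (\<lambda>q. \<partial> F q v) x u) (\<partial> F x z) = bil (g x) (Christoffel g x u v) z"
proof -
  have *: "bil (\<partial> g x u) v w = amb x (cov G F (\<lambda>q. \<partial> F q v) x u) (\<partial> F x w)
      + amb x (cov G F (\<lambda>q. \<partial> F q w) x u) (\<partial> F x v)" for u v w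
  proof -
    have "bil (\<partial> g x u) v w = \<partial> (\<lambda>q. bil (g q) v w) x u"
      by (rule ind.pder_bil_G[OF x, symmetric])
    also have "\<dots> = \<partial> (\<lambda>q. bil (G (F q)) (\<partial> F q v) (\<partial> F q w)) x u"
      by (rule pder_cong_open[OF open_\<Omega> x induced])
    finally show ?thesis
      by (simp add: pder_bil[OF smooth_pder_F smooth_pder_F x] amb_sym[OF x, of "\<partial> F x v"])
  qed
  show ?thesis
    unfolding ind.Koszul[OF x] *
    using cov_pder_commute[OF x, of v u] cov_pder_commute[OF x, of z u] cov_pder_commute[OF x, of z v]
    by simp
qed

lemma gauss': "x \<in> \<Omega> \<Longrightarrow> amb x (\<partial> F x z) (cov G F (\<lambda>q. \<partial> F q v) x u) = bil (g x) (Christoffel g x u v) z"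
  using gauss amb_sym by metis

text \<open>Differentiate the orthogonality of \<open>\<xi>\<close> and the tangent vectors \<open>\<partial> F q v\<close>.\<close>

lemma second_fundamental_form:
  assumes x: "x \<in> \<Omega>"
  shows "bil (g x) (A x *v u) v = amb x (\<xi> x) (cov G F (\<lambda>q. \<partial> F q v) x u)"
proof -
  have "\<partial> (\<lambda>q. bil (G (F q)) (\<xi> q) (\<partial> F q v)) x u = \<partial> (\<lambda>q. 0) x u"
    by (rule pder_cong_open[OF open_\<Omega> x normal])
  then show ?thesis
    by (simp add: pder_bil[OF smooth_\<xi> smooth_pder_F x] weingarten[OF x] bil_minus induced[OF x])
qed

lemma shape_self_adjoint: "x \<in> \<Omega> \<Longrightarrow> bil (g x) (A x *v u) v = bil (g x) (A x *v v) u"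
  by (simp add: second_fundamental_form cov_pder_commute[of x v])

lemma shape_self_adjoint': "x \<in> \<Omega> \<Longrightarrow> bil (g x) (A x *v u) v = bil (g x) u (A x *v v)"
  using shape_self_adjoint ind.sym by metis

text \<open>The vector \<open>A q *v v\<close> is the solution of a linear system with matrix \<open>g q\<close>, whose right-hand side is
  given by the Weingarten formula.\<close>

lemma smooth_shape: "smooth_on \<Omega> A"
proof -
  have "smooth_on \<Omega> (\<lambda>q. A q *v v)" for v
  proof -
    have s: "smooth_on \<Omega> (\<lambda>q. \<chi> l. - amb q (cov G F \<xi> q v) (\<partial> F q (axis l 1)))"
      by (intro smooth_on_vec smooth_on_minus smooth_bil smooth_cov smooth_\<xi> smooth_pder_F open_\<Omega>)
    have eq: "matrix_inv (g q) *v (\<chi> l. - amb q (cov G F \<xi> q v) (\<partial> F q (axis l 1))) = A q *v v"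
      if q: "q \<in> \<Omega>" for q
    proof -
      have "(g q *v (A q *v v)) $ l = - amb q (cov G F \<xi> q v) (\<partial> F q (axis l 1))" for l
      proof -
        have "(g q *v (A q *v v)) $ l = bil (g q) (axis l 1) (A q *v v)"
          by (simp add: bil_def inner_axis')
        also have "\<dots> = bil (g q) (A q *v v) (axis l 1)" by (rule ind.sym[OF q])
        finally show ?thesis by (simp add: induced[OF q] weingarten[OF q] bil_minus)
      qed
      then have "(\<chi> l. - amb q (cov G F \<xi> q v) (\<partial> F q (axis l 1))) = g q *v (A q *v v)"
        by (simp add: vec_eq_iff)
      then show ?thesis by (simp add: matrix_inv_mult(1)[OF ind.invertible_G[OF q]])
    qed
    show ?thesis
      by (rule smooth_on_cong[OF open_\<Omega> eq smooth_on_matrix_inv[OF open_\<Omega> smooth_g ind.invertible_G s]])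
  qed
  then have "smooth_on \<Omega> (\<lambda>q. (A q *v axis j 1) $ i)" for i j
    by (intro smooth_on_nth open_\<Omega>)
  then have "smooth_on \<Omega> (\<lambda>q. \<chi> i. \<chi> j. A q $ i $ j)"
    by (intro smooth_on_vec open_\<Omega>) (simp add: matrix_vector_mult_basis column_def)
  then show ?thesis by (simp add: vec_lambda_eta)
qed

text \<open>Second covariant derivative of a field along \<open>F\<close>. The correction by the Levi-Civita connection of the
  hypersurface makes it tensorial in \<open>u\<close>, \<open>v\<close>, so that it can be contracted with the values of a frame
  at a single point.\<close>

definition hess :: "(real^'n \<Rightarrow> real^'k) \<Rightarrow> real^'n \<Rightarrow> real^'n \<Rightarrow> real^'n \<Rightarrow> real^'k" where
  "hess V x u v = cov G F (\<lambda>q. cov G F V q v) x u - cov G F V x (Christoffel g x u v)"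

lemma hess_tangential:
  assumes x: "x \<in> \<Omega>"
  shows "amb x (hess \<xi> x u v) (\<partial> F x z) =
    - bil (g x) (\<partial> A x u *v v + Christoffel g x u (A x *v v) - A x *v Christoffel g x u v) z"
proof -
  have sA: "smooth_on \<Omega> (\<lambda>q. A q *v v)"
    by (rule smooth_on_linear[OF open_\<Omega> _ smooth_shape])
      (simp add: linear_conv_bounded_linear[symmetric] linear_iff matrix_vector_mult_add_rdistrib
        scaleR_matrix_vector_assoc)
  have dA: "\<partial> (\<lambda>q. A q *v v) x u = \<partial> A x u *v v"
    by (rule pder_linear[OF _ smooth_shape x])
      (simp add: linear_conv_bounded_linear[symmetric] linear_iff matrix_vector_mult_add_rdistrib
        scaleR_matrix_vector_assoc)
  have "cov G F (\<lambda>q. cov G F \<xi> q v) x u = cov G F (\<lambda>q. (-1) *\<^sub>R \<partial> F q (A q *v v)) x u"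
    by (rule cov_cong_open[OF open_\<Omega> x]) (simp add: weingarten)
  also have "\<dots> = - cov G F (\<lambda>q. \<partial> F q (A q *v v)) x u"
    using cov_scaleR[OF smooth_on_const smooth_on_linear_family[OF open_\<Omega> linear_pder_F smooth_pder_F sA] x, of "-1"]
    by simp
  also have "cov G F (\<lambda>q. \<partial> F q (A q *v v)) x u =
      cov G F (\<lambda>q. \<partial> F q (A x *v v)) x u + \<partial> F x (\<partial> A x u *v v)"
    using pder_linear_family[OF open_\<Omega> linear_pder_F smooth_pder_F sA x, of u]
    by (simp add: cov_def dA)
  finally have "hess \<xi> x u v = - (cov G F (\<lambda>q. \<partial> F q (A x *v v)) x u + \<partial> F x (\<partial> A x u *v v))
      + \<partial> F x (A x *v Christoffel g x u v)"
    by (simp add: hess_def weingarten[OF x])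
  then show ?thesis
    by (simp add: bil_add bil_diff bil_minus gauss[OF x] induced[OF x])
qed

text \<open>Up to sign, \<open>amb x (hess \<xi> x u v) (\<partial> F x z)\<close> is the covariant derivative of the second fundamental
  form in direction \<open>u\<close>. The Codazzi equation says that it is totally symmetric: exchanging \<open>u\<close> and \<open>v\<close>
  costs a curvature term, which is normal to the hypersurface, and exchanging \<open>v\<close> and \<open>z\<close> is possible
  as the second fundamental form is symmetric.\<close>

lemma codazzi_swap_12:
  assumes x: "x \<in> \<Omega>"
  shows "amb x (hess \<xi> x u v) (\<partial> F x z) = amb x (hess \<xi> x v u) (\<partial> F x z)"
proof -
  have "hess \<xi> x u v = hess \<xi> x v u + riem G (F x) (\<partial> F x u) (\<partial> F x v) (\<xi> x)"
    using cov_commutator[OF smooth_\<xi> x, of v u]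
    by (simp add: hess_def ind.Christoffel_sym[OF x, of u v] algebra_simps)
  then show ?thesis by (simp add: bil_add riem_normal[OF x])
qed

lemma codazzi_swap_23:
  assumes x: "x \<in> \<Omega>"
  shows "amb x (hess \<xi> x u v) (\<partial> F x z) = amb x (hess \<xi> x u z) (\<partial> F x v)"
proof -
  have 1: "amb x (hess \<xi> x u v) (\<partial> F x z) = - \<partial> (\<lambda>q. bil (g q) (A q *v v) z) x u
      + bil (g x) (A x *v Christoffel g x u z) v + bil (g x) (A x *v Christoffel g x u v) z" for v z
  proof -
    have "\<partial> (\<lambda>q. bil (G (F q)) ((-1) *\<^sub>R cov G F \<xi> q v) (\<partial> F q z)) x u
        = \<partial> (\<lambda>q. bil (g q) (A q *v v) z) x u"
      by (rule pder_cong_open[OF open_\<Omega> x]) (simp add: weingarten induced)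
    moreover have "\<partial> (\<lambda>q. bil (G (F q)) ((-1) *\<^sub>R cov G F \<xi> q v) (\<partial> F q z)) x u
        = - amb x (cov G F (\<lambda>q. cov G F \<xi> q v) x u) (\<partial> F x z)
          + bil (g x) (A x *v v) (Christoffel g x u z)"
      unfolding pder_bil[OF smooth_on_scaleR[OF open_\<Omega> smooth_on_const smooth_cov[OF smooth_\<xi>]] smooth_pder_F x]
        cov_scaleR[OF smooth_on_const smooth_cov[OF smooth_\<xi>] x]
      using gauss'[OF x, of "A x *v v" z u] ind.sym[OF x, of "Christoffel g x u z"]
      by (simp add: weingarten[OF x] bil_minus)
    ultimately show ?thesis
      by (simp add: hess_def bil_add bil_diff weingarten[OF x] bil_minus induced[OF x, symmetric]
          shape_self_adjoint[OF x, of v "Christoffel g x u z"])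
  qed
  have "\<partial> (\<lambda>q. bil (g q) (A q *v v) z) x u = \<partial> (\<lambda>q. bil (g q) (A q *v z) v) x u"
    by (rule pder_cong_open[OF open_\<Omega> x]) (rule shape_self_adjoint)
  then show ?thesis by (simp add: 1)
qed

lemma bounded_linear_trace: "bounded_linear (trace :: real^'n^'n \<Rightarrow> real)"
  by (simp add: linear_conv_bounded_linear[symmetric] linear_iff trace_def sum.distrib sum_distrib_left)

text \<open>By total symmetry the direction \<open>z\<close> can be moved to the differentiating slot, so that the sum becomes
  the trace of the covariant derivative of \<open>A\<close> in direction \<open>z\<close>. There the Christoffel symbols enter
  through a commutator, which has trace zero.\<close>

lemma contracted_codazzi:
  assumes x: "x \<in> \<Omega>" and e: "orthonormal_frame (g x) \<sigma> e"
  shows "(\<Sum>i\<in>UNIV. \<sigma> i * amb x (hess \<xi> x (e i) (e i)) (\<partial> F x z)) = - \<partial> (\<lambda>q. trace (A q)) x z"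
proof -
  define C where "C = matrix (Christoffel g x z)"
  have C: "C *v u = Christoffel g x z u" for u
    unfolding C_def by (simp only: matrix_vector_mul(2)[OF ind.linear_Christoffel_right[OF x]])
  define L where "L = \<partial> A x z + C ** A x - A x ** C"
  have L: "L *v u = \<partial> A x z *v u + Christoffel g x z (A x *v u) - A x *v Christoffel g x z u" for u
    by (simp add: L_def matrix_vector_mult_add_rdistrib matrix_vector_mult_diff_rdistrib C
        matrix_vector_mul_assoc[symmetric])
  have "amb x (hess \<xi> x (e i) (e i)) (\<partial> F x z) = - bil (g x) (e i) (L *v e i)" for i
  proof -
    have "amb x (hess \<xi> x (e i) (e i)) (\<partial> F x z) = amb x (hess \<xi> x z (e i)) (\<partial> F x (e i))"
      using codazzi_swap_12[OF x] codazzi_swap_23[OF x] by metis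
    also have "\<dots> = - bil (g x) (L *v e i) (e i)" unfolding L by (rule hess_tangential[OF x])
    finally show ?thesis using ind.sym[OF x] by simp
  qed
  then have "(\<Sum>i\<in>UNIV. \<sigma> i * amb x (hess \<xi> x (e i) (e i)) (\<partial> F x z)) = - trace L"
    by (simp add: sum_negf orthonormal_frame_trace[OF e])
  also have "trace L = trace (\<partial> A x z)"
    by (simp add: L_def trace_add trace_sub trace_mul_sym[of C])
  also have "\<dots> = \<partial> (\<lambda>q. trace (A q)) x z"
    by (rule pder_linear[OF bounded_linear_trace smooth_shape x, symmetric])
  finally show ?thesis .
qed

text \<open>Differentiate the orthogonality of \<open>\<xi>\<close> and its own derivatives, which are tangential.\<close>

lemma hess_normal:
  assumes x: "x \<in> \<Omega>"
  shows "amb x (hess \<xi> x u v) (\<xi> x) = - bil (g x) (A x *v v) (A x *v u)"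
proof -
  have "\<partial> (\<lambda>q. bil (G (F q)) (cov G F \<xi> q v) (\<xi> q)) x u = \<partial> (\<lambda>q. 0) x u"
    by (rule pder_cong_open[OF open_\<Omega> x]) (simp add: weingarten bil_minus normal')
  then have "amb x (cov G F (\<lambda>q. cov G F \<xi> q v) x u) (\<xi> x) = - bil (g x) (A x *v v) (A x *v u)"
    by (simp add: pder_bil[OF smooth_cov[OF smooth_\<xi>] smooth_\<xi> x] weingarten[OF x] bil_minus induced[OF x])
  then show ?thesis by (simp add: hess_def bil_add weingarten[OF x] normal'[OF x])
qed

lemma hess_scaleR:
  assumes h: "smooth_on \<Omega> h" and V: "smooth_on \<Omega> V" and x: "x \<in> \<Omega>"
  shows "hess (\<lambda>q. h q *\<^sub>R V q) x u v =
    (\<partial> (\<lambda>q. \<partial> h q v) x u - \<partial> h x (Christoffel g x u v)) *\<^sub>R V x + \<partial> h x v *\<^sub>R cov G F V x u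
      + \<partial> h x u *\<^sub>R cov G F V x v + h x *\<^sub>R hess V x u v"
proof -
  note dh = smooth_on_pder[OF h] and cV = smooth_cov[OF V]
  have "cov G F (\<lambda>q. cov G F (\<lambda>q. h q *\<^sub>R V q) q v) x u
      = cov G F (\<lambda>q. \<partial> h q v *\<^sub>R V q + h q *\<^sub>R cov G F V q v) x u"
    by (rule cov_cong_open[OF open_\<Omega> x]) (rule cov_scaleR[OF h V])
  also have "\<dots> = cov G F (\<lambda>q. \<partial> h q v *\<^sub>R V q) x u + cov G F (\<lambda>q. h q *\<^sub>R cov G F V q v) x u"
    by (intro cov_add smooth_on_scaleR open_\<Omega> dh V h cV x)
  finally show ?thesis
    by (simp add: hess_def cov_scaleR[OF dh V x] cov_scaleR[OF h cV x] cov_scaleR[OF h V x] algebra_simps)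
qed

text \<open>Tangential part of the equation for \<open>h \<xi>\<close>: the mixed terms of the product rule contribute
  \<open>- 2 A (grad h)\<close> and the second derivative of \<open>\<xi>\<close> contributes \<open>- h\<close> times the gradient of \<open>trace A\<close>,
  which is \<open>CARD('n) \<epsilon> grad h\<close>.\<close>

lemma shape_gradient:
  fixes h :: "real^'n \<Rightarrow> real" and e :: "'n \<Rightarrow> real^'n" and \<sigma> :: "'n \<Rightarrow> real"
  assumes h: "\<And>q. q \<in> \<Omega> \<Longrightarrow> h q = \<epsilon> / CARD('n) * trace (A q)"
    and x: "x \<in> \<Omega>" and e: "orthonormal_frame (g x) \<sigma> e"
    and lap: "(\<Sum>i\<in>UNIV. \<sigma> i *\<^sub>R hess (\<lambda>q. h q *\<^sub>R \<xi> q) x (e i) (e i)) = r *\<^sub>R \<xi> x"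
  defines "grad \<equiv> \<Sum>i\<in>UNIV. (\<sigma> i * \<partial> h x (e i)) *\<^sub>R e i"
  shows "A x *v grad = (- (CARD('n) * \<epsilon> * h x / 2)) *\<^sub>R grad" and "bil (g x) grad z = \<partial> h x z"
proof -
  have tr: "smooth_on \<Omega> (\<lambda>q. trace (A q))"
    by (rule smooth_on_linear[OF open_\<Omega> bounded_linear_trace smooth_shape])
  have sh: "smooth_on \<Omega> h"
    by (rule smooth_on_cong[OF open_\<Omega> h[symmetric] smooth_on_mult[OF open_\<Omega> smooth_on_const tr]])
  have dtr: "\<partial> (\<lambda>q. trace (A q)) x z = CARD('n) * \<epsilon> * \<partial> h x z" for z
  proof -
    have "\<partial> h x z = \<partial> (\<lambda>q. (\<epsilon> / CARD('n)) *\<^sub>R trace (A q)) x z"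
      by (rule pder_cong_open[OF open_\<Omega> x]) (simp add: h)
    also have "\<dots> = \<epsilon> / CARD('n) * \<partial> (\<lambda>q. trace (A q)) x z"
      by (simp only: pder_linear[OF bounded_linear_scaleR_right tr x]) simp
    finally show ?thesis using \<epsilon> by auto
  qed
  have ldh: "linear (\<partial> h x)" by (rule linear_pder[OF sh x])
  have grad: "bil (g x) grad z = \<partial> h x z" for z
  proof -
    have "bil (g x) grad z = (\<Sum>i\<in>UNIV. \<sigma> i * bil (g x) (e i) z * \<partial> h x (e i))"
      by (simp add: grad_def bil_sum bil_scaleR mult.assoc mult.commute[of "\<partial> h x _"])
    also have "\<dots> = \<partial> h x (\<Sum>i\<in>UNIV. (\<sigma> i * bil (g x) (e i) z) *\<^sub>R e i)"
      by (simp add: linear_sum[OF ldh] linear_cmul[OF ldh])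
    finally show ?thesis by (simp add: orthonormal_frame_expansion[OF e])
  qed
  then show "bil (g x) grad z = \<partial> h x z" .
  show "A x *v grad = (- (CARD('n) * \<epsilon> * h x / 2)) *\<^sub>R grad"
  proof (rule ind.bil_eqI[OF x])
    fix z
    have hz: "amb x (hess (\<lambda>q. h q *\<^sub>R \<xi> q) x u u) (\<partial> F x z) =
        - 2 * \<partial> h x u * bil (g x) (A x *v u) z + h x * amb x (hess \<xi> x u u) (\<partial> F x z)" for u
      unfolding hess_scaleR[OF sh smooth_\<xi> x] bil_add bil_scaleR normal[OF x] weingarten[OF x]
        bil_minus induced[OF x]
      by simp
    have "0 = amb x (\<Sum>i\<in>UNIV. \<sigma> i *\<^sub>R hess (\<lambda>q. h q *\<^sub>R \<xi> q) x (e i) (e i)) (\<partial> F x z)"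
      by (simp add: lap bil_scaleR normal[OF x])
    also have "\<dots> = (\<Sum>i\<in>UNIV. \<sigma> i * (- 2 * \<partial> h x (e i) * bil (g x) (A x *v e i) z
        + h x * amb x (hess \<xi> x (e i) (e i)) (\<partial> F x z)))"
      by (simp only: bil_sum bil_scaleR hz real_scaleR_def)
    also have "\<dots> = - 2 * (\<Sum>i\<in>UNIV. \<sigma> i * \<partial> h x (e i) * bil (g x) (A x *v e i) z)
        + h x * (\<Sum>i\<in>UNIV. \<sigma> i * amb x (hess \<xi> x (e i) (e i)) (\<partial> F x z))"
      by (simp add: sum_distrib_left sum.distrib[symmetric] algebra_simps)
    also have "(\<Sum>i\<in>UNIV. \<sigma> i * \<partial> h x (e i) * bil (g x) (A x *v e i) z) = bil (g x) (A x *v grad) z"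
      by (simp add: grad_def linear_sum[OF matrix_vector_mul_linear] bil_sum matrix_vector_mult_scaleR bil_scaleR)
    finally have "0 = - 2 * bil (g x) (A x *v grad) z + h x * - (CARD('n) * \<epsilon> * \<partial> h x z)"
      unfolding contracted_codazzi[OF x e] dtr .
    then have "bil (g x) (A x *v grad) z = - (CARD('n) * \<epsilon> * h x / 2) * \<partial> h x z"
      by (simp add: field_simps)
    then show "bil (g x) (A x *v grad) z = bil (g x) ((- (CARD('n) * \<epsilon> * h x / 2)) *\<^sub>R grad) z"
      by (simp only: bil_scaleR grad real_scaleR_def)
  qed
qed

text \<open>Normal part of the same equation. Near a point where \<open>h\<close> is locally constant, only the second
  derivative of \<open>\<xi>\<close> survives, with normal component given by \<open>hess_normal\<close>.\<close>

lemma shape_square_trace: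
  fixes h :: "real^'n \<Rightarrow> real" and e :: "'n \<Rightarrow> real^'n" and \<sigma> :: "'n \<Rightarrow> real"
  assumes sh: "smooth_on \<Omega> h" and x: "x \<in> \<Omega>"
    and U: "open U" "x \<in> U" and const: "\<And>q v. q \<in> U \<Longrightarrow> \<partial> h q v = 0"
    and e: "orthonormal_frame (g x) \<sigma> e"
    and lap: "(\<Sum>i\<in>UNIV. \<sigma> i *\<^sub>R hess (\<lambda>q. h q *\<^sub>R \<xi> q) x (e i) (e i)) = r *\<^sub>R \<xi> x"
  shows "h x * trace (A x ** A x) = - \<epsilon> * r"
proof -
  have "\<partial> (\<lambda>q. \<partial> h q v) x u = \<partial> (\<lambda>q. 0) x u" for u v
    by (rule pder_cong_open[OF U]) (rule const)
  then have 0: "\<partial> (\<lambda>q. \<partial> h q v) x u = 0" for u v by simp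
  have "r * \<epsilon> = amb x (\<Sum>i\<in>UNIV. \<sigma> i *\<^sub>R hess (\<lambda>q. h q *\<^sub>R \<xi> q) x (e i) (e i)) (\<xi> x)"
    by (simp add: lap bil_scaleR unit[OF x])
  also have "\<dots> = (\<Sum>i\<in>UNIV. - (h x * (\<sigma> i * bil (g x) (e i) ((A x ** A x) *v e i))))"
  proof -
    have "bil (g x) (A x *v u) (A x *v u) = bil (g x) u ((A x ** A x) *v u)" for u
      using shape_self_adjoint'[OF x, of u "A x *v u"] by (simp add: matrix_vector_mul_assoc)
    then show ?thesis
      by (simp add: bil_sum bil_scaleR hess_scaleR[OF sh smooth_\<xi> x] 0 const[OF U(2)] hess_normal[OF x]
          ac_simps)
  qed
  also have "\<dots> = - (h x * trace (A x ** A x))"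
    by (simp add: sum_negf sum_distrib_left[symmetric] orthonormal_frame_trace[OF e])
  finally show ?thesis by (simp add: mult.commute)
qed

end

section \<open>Matrices with a single eigenvalue\<close>

text \<open>As a polynomial in \<open>t\<close>, \<open>det (1 - t M)\<close> has no complex root, so it is constant; its linear coefficient is
  \<open>- trace M\<close>.\<close>

lemma trace_zero_if_no_nonzero_eigenvalue:
  fixes M :: "complex^'n^'n"
  assumes no: "\<And>v \<mu>. v \<noteq> 0 \<Longrightarrow> M *v v = \<mu> *s v \<Longrightarrow> \<mu> = 0"
  shows "trace M = 0"
proof -
  define e where "e i j = [:if i = j then 1 else 0, - M $ i $ j:]" for i j
  define P where "P = det (\<chi> i j. e i j)"
  have ev: "poly P t = det (\<chi> i j. (if i = j then 1 else 0) - t * M $ i $ j)" for t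
    by (simp add: P_def det_def e_def poly_sum poly_prod)
  have "poly P t \<noteq> 0" for t
  proof
    let ?N = "\<chi> i j. (if i = j then 1 else 0) - t * M $ i $ j"
    assume "poly P t = 0"
    then have "\<not> invertible ?N" by (simp add: ev invertible_det_nz)
    then obtain v where v: "v \<noteq> 0" "?N *v v = 0"
      by (auto simp: invertible_left_inverse matrix_left_invertible_ker)
    have "?N *v v = v - t *s (M *v v)"
      by (simp add: vec_eq_iff matrix_vector_mult_def left_diff_distrib sum_subtractf sum_distrib_left
          if_distrib[of "\<lambda>c. c * _"] sum.delta' mult.assoc cong: if_cong)
    then have tv: "t *s (M *v v) = v" using v by simp
    then have t: "t \<noteq> 0" using v by auto
    have "M *v v = (1 / t) *s v"
      by (subst tv[symmetric], simp only: vector_smult_assoc) (use t in simp)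
    then show False using no[OF v(1)] t by force
  qed
  then have "constant (poly P)" using fundamental_theorem_of_algebra by blast
  then have "P = [:poly P 0:]" using constant_degree[of P] by (metis degree_0_id poly_0_coeff_0 degree_eq_zeroE poly_const_conv)
  then have "coeff P 1 = 0" by (metis coeff_pCons_Suc coeff_0 One_nat_def)
  moreover have "coeff P 1 = - trace M"
  proof -
    have c1: "coeff Q 1 = poly (pderiv Q) 0" for Q :: "complex poly"
      by (simp add: poly_0_coeff_0 coeff_pderiv)
    have summand: "poly (pderiv (of_int (sign p) * (\<Prod>i\<in>UNIV. e i (p i)))) 0 = (if p = id then - trace M else 0)"
      if p: "p permutes UNIV" for p
    proof -
      have "pderiv (of_int (sign p) * Q) = of_int (sign p) * pderiv Q" for Q :: "complex poly"
        by (simp add: pderiv_mult of_int_poly pderiv_smult)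
      then have eq: "poly (pderiv (of_int (sign p) * (\<Prod>i\<in>UNIV. e i (p i)))) 0 = of_int (sign p) *
          (\<Sum>i\<in>UNIV. - (M $ i $ p i * (\<Prod>j\<in>UNIV - {i}. if j = p j then 1 else 0)))"
        by (simp add: pderiv_prod poly_sum poly_prod e_def pderiv_pCons)
      show ?thesis
      proof (cases "p = id")
        case True
        then show ?thesis unfolding eq by (simp add: trace_def sum_negf)
      next
        case False
        then obtain a where a: "p a \<noteq> a" by (auto simp: fun_eq_iff)
        \<comment> \<open>\<open>p\<close> moves both \<open>a\<close> and \<open>p a\<close>, and removing one factor from the product leaves a zero.\<close>
        have pa: "p (p a) \<noteq> p a" using a permutes_inj[OF p] by (auto dest: injD)
        have z: "(\<Prod>j\<in>UNIV - {i}. if j = p j then 1 else (0::complex)) = 0" for i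
        proof (cases "i = a")
          case True
          then show ?thesis using a pa by (intro prod_zero) (auto intro!: bexI[of _ "p a"])
        next
          case False
          then show ?thesis using a by (intro prod_zero) (auto intro!: bexI[of _ a])
        qed
        show ?thesis unfolding eq z using False by simp
      qed
    qed
    have "coeff P 1 = (\<Sum>p | p permutes (UNIV::'n set). if p = id then - trace M else 0)"
      unfolding P_def det_def coeff_sum vec_lambda_beta
      by (rule sum.cong[OF refl]) (simp only: c1 summand mem_Collect_eq)
    then show ?thesis by (simp add: sum.delta' permutes_id)
  qed
  ultimately show ?thesis by simp
qed

text \<open>Over the complex numbers, subtracting the eigenvalue leaves a matrix \<open>N\<close> whose only eigenvalue is \<open>0\<close>, and the
  same holds for \<open>N ** N\<close>. So both have trace zero, which yields the two traces of \<open>S\<close>; the first shows that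
  the eigenvalue is real.\<close>

lemma single_principal_curvature:
  fixes S :: "real^'n^'n"
  assumes "\<exists>!\<mu>. principal_curvature S \<mu>"
  obtains m :: real where "trace S = CARD('n) * m" "trace (S ** S) = CARD('n) * m\<^sup>2"
    "\<And>v a. v \<noteq> 0 \<Longrightarrow> S *v v = a *\<^sub>R v \<Longrightarrow> a = m"
proof -
  define C where "C = (\<chi> i j. complex_of_real (S $ i $ j))"
  obtain \<mu> where \<mu>: "\<And>v \<nu>. v \<noteq> 0 \<Longrightarrow> C *v v = \<nu> *s v \<Longrightarrow> \<nu> = \<mu>"
    using assms unfolding principal_curvature_def C_def by metis
  define N where "N = C - mat \<mu>"
  have mv: "mat c *v v = c *s v" for c :: complex and v :: "complex^'n"
    by (simp add: vec_eq_iff matrix_vector_mult_def mat_def if_distrib[of "\<lambda>c. c * _"] sum.delta' cong: if_cong)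
  have Nv: "N *v v = C *v v - \<mu> *s v" for v
    by (simp add: N_def matrix_vector_mult_diff_rdistrib mv)
  have N0: "\<nu> = 0" if "v \<noteq> 0" "N *v v = \<nu> *s v" for v \<nu>
  proof -
    have "C *v v = (\<nu> + \<mu>) *s v" using that(2) by (simp add: Nv vector_sadd_rdistrib algebra_simps)
    then have "\<nu> + \<mu> = \<mu>" by (rule \<mu>[OF that(1)])
    then show ?thesis by simp
  qed
  have "trace N = 0" using N0 by (rule trace_zero_if_no_nonzero_eigenvalue)
  have NN0: "\<nu> = 0" if v: "v \<noteq> 0" "(N ** N) *v v = \<nu> *s v" for v \<nu>
  proof -
    define s where "s = csqrt \<nu>"
    have s: "s * s = \<nu>" unfolding s_def by (metis power2_csqrt power2_eq_square)
    \<comment> \<open>\<open>(N + s)(N - s) v = 0\<close>, so \<open>w\<close> is an eigenvector for \<open>- s\<close> unless \<open>v\<close> is one for \<open>s\<close>.\<close>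
    define w where "w = N *v v - s *s v"
    have "N *v w = (- s) *s w"
      using v(2) s by (simp add: w_def matrix_vector_mult_diff_distrib matrix_vector_mul_assoc
          vec_eq_iff vector_scalar_commute algebra_simps)
    then have "w \<noteq> 0 \<Longrightarrow> s = 0" using N0[of w "- s"] by simp
    moreover have "w = 0 \<Longrightarrow> s = 0" using N0[OF v(1), of s] by (simp add: w_def)
    ultimately have "s = 0" by blast
    then show ?thesis using s by simp
  qed
  have "trace (N ** N) = 0" using NN0 by (rule trace_zero_if_no_nonzero_eigenvalue)
  have trm: "trace (mat c :: complex^'n^'n) = CARD('n) * c" for c :: complex
    by (simp add: trace_def mat_def)
  have trC: "trace C = CARD('n) * \<mu>"
    using \<open>trace N = 0\<close> by (simp add: N_def trace_sub trm)
  have CC: "C ** C = N ** N + (\<chi> i j. 2 * \<mu> * N $ i $ j) + mat (\<mu> * \<mu>)"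
  proof -
    have CN: "C = N + mat \<mu>" by (simp add: N_def)
    have "(C ** C) *v v = (N ** N + (\<chi> i j. 2 * \<mu> * N $ i $ j) + mat (\<mu> * \<mu>)) *v v" for v
    proof -
      have "(\<chi> i j. 2 * \<mu> * N $ i $ j) *v v = (2 * \<mu>) *s (N *v v)"
        by (simp add: vec_eq_iff matrix_vector_mult_def sum_distrib_left mult.assoc)
      then show ?thesis
        by (simp add: CN matrix_vector_mul_assoc[symmetric] matrix_vector_mult_add_rdistrib mv
            matrix_vector_right_distrib vec_eq_iff vector_scalar_commute algebra_simps)
    qed
    then show ?thesis by (simp add: matrix_eq)
  qed
  have trCC: "trace (C ** C) = CARD('n) * \<mu>\<^sup>2"
  proof -
    have "trace (\<chi> i j. 2 * \<mu> * N $ i $ j) = 2 * \<mu> * trace N"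
      by (simp add: trace_def sum_distrib_left)
    then show ?thesis
      by (simp add: CC trace_add trm \<open>trace N = 0\<close> \<open>trace (N ** N) = 0\<close> power2_eq_square)
  qed
  have rC: "trace C = complex_of_real (trace S)" by (simp add: trace_def C_def)
  define m where "m = trace S / CARD('n)"
  have m: "\<mu> = complex_of_real m" using trC by (simp add: rC m_def field_simps)
  have rCC: "trace (C ** C) = complex_of_real (trace (S ** S))"
    by (simp add: trace_def C_def matrix_matrix_mult_def)
  show ?thesis
  proof (rule that[of m])
    show "trace S = CARD('n) * m" by (simp add: m_def)
    have "complex_of_real (trace (S ** S)) = complex_of_real (CARD('n) * m\<^sup>2)"
      using trCC by (simp add: rCC m)
    then show "trace (S ** S) = CARD('n) * m\<^sup>2" by (simp only: of_real_eq_iff)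
    fix v a assume v: "v \<noteq> 0" "S *v v = a *\<^sub>R v"
    let ?c = "\<chi> i. complex_of_real (v $ i)"
    have "?c \<noteq> 0" using v(1) by (simp add: vec_eq_iff)
    moreover have "C *v ?c = complex_of_real a *s ?c"
    proof -
      have "(C *v ?c) $ i = complex_of_real ((S *v v) $ i)" for i
        by (simp add: C_def matrix_vector_mult_def)
      then show ?thesis by (simp add: vec_eq_iff v(2))
    qed
    ultimately have "complex_of_real a = \<mu>" by (rule \<mu>)
    then show "a = m" by (simp add: m)
  qed
qed

section \<open>The local dichotomy\<close>

context hypersurface_patch
begin

text \<open>Where \<open>h\<close> does not vanish, a nonzero gradient of \<open>h\<close> would be an eigenvector of \<open>A\<close> for a multiple of
  the single eigenvalue \<open>\<epsilon> h\<close> by the negative factor \<open>- CARD('n) / 2\<close>. So \<open>h\<close> is locally constant there, and the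
  normal part of the equation determines its square.\<close>

lemma mean_curvature_dichotomy:
  fixes h :: "real^'n \<Rightarrow> real"
  assumes h: "\<And>q. q \<in> \<Omega> \<Longrightarrow> h q = \<epsilon> / CARD('n) * trace (A q)"
    and lap: "\<And>q. q \<in> \<Omega> \<Longrightarrow> \<exists>\<sigma> e. orthonormal_frame (g q) \<sigma> e \<and>
      (\<Sum>i\<in>UNIV. \<sigma> i *\<^sub>R hess (\<lambda>q. h q *\<^sub>R \<xi> q) q (e i) (e i)) = (- lam * h q) *\<^sub>R \<xi> q"
    and single: "\<And>q. q \<in> \<Omega> \<Longrightarrow> \<exists>!\<mu>. principal_curvature (A q) \<mu>"
    and x: "x \<in> \<Omega>"
  shows "h x = 0 \<or> CARD('n) * (h x)\<^sup>2 = \<epsilon> * lam" and "continuous_on \<Omega> h"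
proof -
  have tr: "smooth_on \<Omega> (\<lambda>q. trace (A q))"
    by (rule smooth_on_linear[OF open_\<Omega> bounded_linear_trace smooth_shape])
  have sh: "smooth_on \<Omega> h"
    by (rule smooth_on_cong[OF open_\<Omega> h[symmetric] smooth_on_mult[OF open_\<Omega> smooth_on_const tr]])
  show cont: "continuous_on \<Omega> h" by (rule smooth_on_continuous[OF sh])
  have mean: "trace (A q ** A q) = CARD('n) * (h q)\<^sup>2"
    "\<And>v a. v \<noteq> 0 \<Longrightarrow> A q *v v = a *\<^sub>R v \<Longrightarrow> a = \<epsilon> * h q" if q: "q \<in> \<Omega>" for q
  proof -
    obtain m :: real where m: "trace (A q) = CARD('n) * m" "trace (A q ** A q) = CARD('n) * m\<^sup>2"
      "\<And>v a. v \<noteq> 0 \<Longrightarrow> A q *v v = a *\<^sub>R v \<Longrightarrow> a = m"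
      by (rule single_principal_curvature[OF single[OF q]]) (rule that)
    have hm: "h q = \<epsilon> * m" using m(1) by (simp add: h[OF q])
    show "trace (A q ** A q) = CARD('n) * (h q)\<^sup>2"
      using \<epsilon> by (auto simp: m(2) hm)
    show "a = \<epsilon> * h q" if "v \<noteq> 0" "A q *v v = a *\<^sub>R v" for v a
      using m(3)[OF that] \<epsilon> by (auto simp: hm)
  qed
  have crit: "\<partial> h q v = 0" if q: "q \<in> \<Omega>" and nz: "h q \<noteq> 0" for q v
  proof -
    obtain \<sigma> e where e: "orthonormal_frame (g q) \<sigma> e" and
      l: "(\<Sum>i\<in>UNIV. \<sigma> i *\<^sub>R hess (\<lambda>q. h q *\<^sub>R \<xi> q) q (e i) (e i)) = (- lam * h q) *\<^sub>R \<xi> q"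
      using lap[OF q] by blast
    let ?grad = "\<Sum>i\<in>UNIV. (\<sigma> i * \<partial> h q (e i)) *\<^sub>R e i"
    note G = shape_gradient[OF h q e l]
    have "?grad = 0"
    proof (rule ccontr)
      assume "?grad \<noteq> 0"
      then have "- (CARD('n) * \<epsilon> * h q / 2) = \<epsilon> * h q" by (rule mean(2)[OF q _ G(1)])
      then have "(real CARD('n) + 2) * (\<epsilon> * h q) = 0" by (simp add: distrib_right)
      moreover have "real CARD('n) + 2 \<noteq> 0" by (smt (verit) of_nat_0_le_iff)
      ultimately show False using nz \<epsilon> by auto
    qed
    then show ?thesis using G(2)[of v] by (simp add: bil_zero)
  qed
  show "h x = 0 \<or> CARD('n) * (h x)\<^sup>2 = \<epsilon> * lam"
  proof (cases "h x = 0")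
    case False
    let ?U = "\<Omega> \<inter> h -` (- {0})"
    have U: "open ?U" using continuous_open_preimage[OF cont open_\<Omega>] by auto
    obtain \<sigma> e where e: "orthonormal_frame (g x) \<sigma> e" and
      l: "(\<Sum>i\<in>UNIV. \<sigma> i *\<^sub>R hess (\<lambda>q. h q *\<^sub>R \<xi> q) x (e i) (e i)) = (- lam * h x) *\<^sub>R \<xi> x"
      using lap[OF x] by blast
    have "h x * trace (A x ** A x) = - \<epsilon> * (- lam * h x)"
      by (rule shape_square_trace[OF sh x U _ _ e l]) (use x False crit in auto)
    then show ?thesis using False by (simp add: mean(1)[OF x])
  qed simp
qed

end

section \<open>Passage to charts\<close>

abbreviation param :: "('p, 'n::finite) chart \<Rightarrow> real^'n \<Rightarrow> 'p" where
  "param c \<equiv> inv_into (fst c) (snd c)"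

lemma
  assumes "smooth_manifold T \<A>" and c: "c \<in> \<A>"
  shows param_chart: "p \<in> fst c \<Longrightarrow> param c (snd c p) = p"
    and open_chart_image: "openin T U \<Longrightarrow> U \<subseteq> fst c \<Longrightarrow> open (snd c ` U)"
    and chart_homeo: "homeomorphic_map (subtopology T (fst c)) (top_of_set (snd c ` fst c)) (snd c)"
    and chart_open: "openin T (fst c)"
    and chart_image_open: "open (snd c ` fst c)"
proof -
  show hom: "homeomorphic_map (subtopology T (fst c)) (top_of_set (snd c ` fst c)) (snd c)"
    and op: "openin T (fst c)" and img: "open (snd c ` fst c)"
    using assms unfolding smooth_manifold_def by blast+
  have top: "topspace (subtopology T (fst c)) = fst c"
    using openin_subset[OF op] by auto
  have "inj_on (snd c) (fst c)" using homeomorphic_imp_injective_map[OF hom] by (simp only: top)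
  then show "p \<in> fst c \<Longrightarrow> param c (snd c p) = p" by (rule inv_into_f_f)
  assume U: "openin T U" "U \<subseteq> fst c"
  then have "openin (subtopology T (fst c)) U"
    by (metis Int_absorb2 openin_subtopology)
  then have "openin (top_of_set (snd c ` fst c)) (snd c ` U)"
    using homeomorphic_imp_open_map[OF hom] unfolding open_map_def by blast
  then show "open (snd c ` U)" using img openin_open_trans by blast
qed

lemma chart_param: "x \<in> snd c ` fst c \<Longrightarrow> snd c (param c x) = x"
  by (rule f_inv_into_f)

lemma param_in: "x \<in> snd c ` fst c \<Longrightarrow> param c x \<in> fst c"
  by (rule inv_into_into)

lemma param_image:
  assumes inv: "\<And>p. p \<in> fst c \<Longrightarrow> param c (snd c p) = p" and U: "U \<subseteq> fst c" and x: "x \<in> snd c ` U"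
  shows "x \<in> snd c ` fst c" "param c x \<in> U"
proof -
  obtain p where p: "p \<in> U" "x = snd c p" using x by blast
  then show "x \<in> snd c ` fst c" "param c x \<in> U" using U inv[of p] by auto
qed

lemma cov_deriv_eq_cov:
  assumes "param c (snd c p) = p" "param d (snd d (f p)) = f p"
  shows "cov_deriv g c d f V p x = cov (g d \<circ> param d) ((snd d \<circ> f) \<circ> param c) (V \<circ> param c) (snd c p) x"
  using assms by (simp add: cov_deriv_def cov_def christoffel_def Christoffel_def chart_deriv_def o_def)

lemma cov_deriv_eq_cov_id:
  assumes M: "smooth_manifold T \<A>" "c \<in> \<A>" and p: "p \<in> fst c"
  shows "cov_deriv g c c id V p x = cov (g c \<circ> param c) id (V \<circ> param c) (snd c p) x"
proof -
  have "\<partial> ((snd c \<circ> id) \<circ> param c) (snd c p) x = \<partial> id (snd c p) x"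
    by (rule pder_cong_open[OF chart_image_open[OF M]]) (use p in \<open>auto simp: chart_param\<close>)
  moreover have pc: "param c (snd c p) = p" by (rule param_chart[OF M p])
  ultimately show ?thesis
    using p by (simp add: cov_deriv_def cov_def christoffel_def Christoffel_def chart_deriv_def comp_def id_def)
qed

text \<open>The chart enters the iterated covariant derivative only through its inverse on the open image, where
  the inner derivative can be replaced by its coordinate expression before differentiating again.\<close>

lemma curvature_eq_riem:
  assumes M: "smooth_manifold T \<A>" "c \<in> \<A>" and p: "p \<in> fst c"
  shows "curvature g c p u v w = riem (g c \<circ> param c) (snd c p) u v w"
proof -
  have eq: "cov_deriv g c c id (\<lambda>q. cov_deriv g c c id (\<lambda>_. w) q v) p u =
      cov (g c \<circ> param c) id (\<lambda>y. cov (g c \<circ> param c) id (\<lambda>_. w) y v) (snd c p) u" for u v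
    unfolding cov_deriv_eq_cov_id[OF M p]
  proof (rule cov_cong_open[OF chart_image_open[OF M]])
    fix y assume y: "y \<in> snd c ` fst c"
    show "((\<lambda>q. cov_deriv g c c id (\<lambda>_. w) q v) \<circ> param c) y = cov (g c \<circ> param c) id (\<lambda>_. w) y v"
      unfolding o_apply cov_deriv_eq_cov_id[OF M param_in[OF y]] chart_param[OF y]
      by (simp only: comp_def)
  qed (use p in simp)
  show ?thesis unfolding curvature_def riem_def eq ..
qed

lemma metric_region_chart:
  assumes "pseudo_riemannian T \<A> g s" "c \<in> \<A>"
  shows "metric_region (snd c ` fst c) (g c \<circ> param c)"
proof
  have M: "smooth_manifold T \<A>" using assms by (simp add: pseudo_riemannian_def)
  show "open (snd c ` fst c)" by (rule chart_image_open[OF M assms(2)])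
  show "smooth_on (snd c ` fst c) (g c \<circ> param c)"
    using assms unfolding pseudo_riemannian_def smooth_in_def by blast
  fix y u assume y: "y \<in> snd c ` fst c"
  show "bil ((g c \<circ> param c) y) u v = bil ((g c \<circ> param c) y) v u" for v
    using assms param_in[OF y] unfolding pseudo_riemannian_def o_apply by blast
  show "u = 0" if "\<And>v. bil ((g c \<circ> param c) y) u v = 0"
    using assms param_in[OF y] that unfolding pseudo_riemannian_def o_apply by blast
qed

locale proper_hypersurface =
  fixes TM :: "'m topology" and AM :: "('m, 'n::finite) chart set" and gM :: "('m, 'n) metric" and r :: nat
    and TN :: "'q topology" and AN :: "('q, 'k::finite) chart set" and gN :: "('q, 'k) metric" and s :: nat
    and \<kappa> lam \<epsilon> :: real
    and f :: "'m \<Rightarrow> 'q"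
    and \<xi> :: "('q, 'k) chart \<Rightarrow> 'm \<Rightarrow> real^'k"
    and A :: "('m, 'n) chart \<Rightarrow> 'm \<Rightarrow> real^'n^'n"
    and H :: "'m \<Rightarrow> real"
  assumes ambient: "space_form TN AN gN s \<kappa>"
    and hypersurface: "pseudo_riemannian TM AM gM r"
    and immersion: "isometric_immersion TM AM gM TN AN gN f"
    and \<epsilon>: "\<epsilon> = 1 \<or> \<epsilon> = -1" and unit_normal: "unit_normal_field AM AN gN f \<xi> \<epsilon>"
    and shape: "shape_operator AM AN gN f \<xi> A"
    and mean_curvature: "c \<in> AM \<Longrightarrow> p \<in> fst c \<Longrightarrow> H p = \<epsilon> / CARD('n) * trace (A c p)"
    and proper: "c \<in> AM \<Longrightarrow> d \<in> AN \<Longrightarrow> p \<in> fst c \<Longrightarrow> f p \<in> fst d \<Longrightarrow>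
      is_laplacian_along TM gM gN f c d (\<lambda>q. H q *\<^sub>R \<xi> d q) p (lam *\<^sub>R (H p *\<^sub>R \<xi> d p))"
    and one_principal_curvature: "c \<in> AM \<Longrightarrow> p \<in> fst c \<Longrightarrow> \<exists>!\<mu>. principal_curvature (A c p) \<mu>"
begin

lemma manifold_M: "smooth_manifold TM AM"
  using hypersurface by (simp add: pseudo_riemannian_def)

lemma pseudo_riemannian_N: "pseudo_riemannian TN AN gN s"
  using ambient by (simp add: space_form_def)

lemma manifold_N: "smooth_manifold TN AN"
  using pseudo_riemannian_N by (simp add: pseudo_riemannian_def)

definition chart_dom :: "('m, 'n) chart \<Rightarrow> ('q, 'k) chart \<Rightarrow> 'm set" where
  "chart_dom c d = fst c \<inter> f -` fst d"

lemma openin_chart_dom: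
  assumes c: "c \<in> AM" and d: "d \<in> AN"
  shows "openin TM (chart_dom c d)"
proof -
  have "continuous_map TM TN f" using immersion by (simp add: isometric_immersion_def)
  then have "openin TM {p \<in> fst c. f p \<in> fst d}"
    by (rule openin_continuous_map_preimage_gen[OF _ chart_open[OF manifold_M c] chart_open[OF manifold_N d]])
  moreover have "{p \<in> fst c. f p \<in> fst d} = chart_dom c d" by (auto simp: chart_dom_def)
  ultimately show ?thesis by simp
qed

context
  fixes c d assumes c: "c \<in> AM" and d: "d \<in> AN"
begin

abbreviation "\<Omega> \<equiv> snd c ` chart_dom c d"
abbreviation "loc_F \<equiv> (snd d \<circ> f) \<circ> param c"
abbreviation "loc_g \<equiv> gM c \<circ> param c"
abbreviation "loc_G \<equiv> gN d \<circ> param d"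
abbreviation "loc_\<xi> \<equiv> \<xi> d \<circ> param c"
abbreviation "loc_A \<equiv> A c \<circ> param c"
abbreviation "loc_H \<equiv> H \<circ> param c"

lemma in_\<Omega>:
  assumes "x \<in> \<Omega>"
  shows "snd c (param c x) = x" "param c x \<in> chart_dom c d" "param c x \<in> fst c" "f (param c x) \<in> fst d"
    "param d (snd d (f (param c x))) = f (param c x)" "loc_F x \<in> snd d ` fst d"
proof -
  have sub: "chart_dom c d \<subseteq> fst c" by (auto simp: chart_dom_def)
  have "x \<in> snd c ` fst c" "param c x \<in> chart_dom c d"
    by (rule param_image[OF param_chart[OF manifold_M c] sub assms], assumption)+
  then show "snd c (param c x) = x" "param c x \<in> chart_dom c d" "param c x \<in> fst c"
    and "f (param c x) \<in> fst d" "param d (snd d (f (param c x))) = f (param c x)"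
      "loc_F x \<in> snd d ` fst d"
    using sub by (auto simp: chart_param chart_dom_def param_chart[OF manifold_N d])
qed

lemma map_region: "map_into_metric_region (snd d ` fst d) loc_G \<Omega> loc_F"
proof -
  have "smooth_on \<Omega> loc_F"
    using immersion c d unfolding isometric_immersion_def smooth_in_def chart_dom_def by blast
  moreover have "open \<Omega>"
    by (rule open_chart_image[OF manifold_M c openin_chart_dom[OF c d]]) (auto simp: chart_dom_def)
  ultimately show ?thesis
    using metric_region_chart[OF pseudo_riemannian_N d] in_\<Omega>(6)
    by (auto intro!: map_into_metric_region.intro map_into_metric_region_axioms.intro simp del: o_apply)
qed

lemma laplacian_terms:
  assumes x: "x \<in> \<Omega>"
  obtains U \<sigma> e where "param c x \<in> U" "local_orthonormal_frame TM gM c U \<sigma> e"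
    "(\<Sum>i\<in>UNIV. \<sigma> i *\<^sub>R
        (cov_deriv gN c d f (\<lambda>q. cov_deriv gN c d f (\<lambda>q. H q *\<^sub>R \<xi> d q) q (e i q)) (param c x) (e i (param c x))
         - cov_deriv gN c d f (\<lambda>q. H q *\<^sub>R \<xi> d q) (param c x)
             (cov_deriv gM c c id (e i) (param c x) (e i (param c x))))) =
      (- lam * loc_H x) *\<^sub>R loc_\<xi> x"
proof -
  obtain U \<sigma> e where *: "param c x \<in> U" "local_orthonormal_frame TM gM c U \<sigma> e"
    "lam *\<^sub>R (H (param c x) *\<^sub>R \<xi> d (param c x)) = - (\<Sum>i\<in>UNIV. \<sigma> i *\<^sub>R
        (cov_deriv gN c d f (\<lambda>q. cov_deriv gN c d f (\<lambda>q. H q *\<^sub>R \<xi> d q) q (e i q)) (param c x) (e i (param c x))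
         - cov_deriv gN c d f (\<lambda>q. H q *\<^sub>R \<xi> d q) (param c x)
             (cov_deriv gM c c id (e i) (param c x) (e i (param c x)))))"
    using proper[OF c d in_\<Omega>(3,4)[OF x]] unfolding is_laplacian_along_def by auto
  from arg_cong[OF *(3), of uminus] show ?thesis
    by (intro that[OF *(1,2)]) simp
qed

lemma frame_at:
  assumes "local_orthonormal_frame TM gM c U \<sigma> e" "param c x \<in> U"
  shows "orthonormal_frame (loc_g x) \<sigma> (\<lambda>i. e i (param c x))"
  using assms unfolding local_orthonormal_frame_def orthonormal_frame_def by simp

lemma induced_metric: "x \<in> \<Omega> \<Longrightarrow>
    bil (loc_g x) u v = bil (loc_G (loc_F x)) (\<partial> loc_F x u) (\<partial> loc_F x v)"
proof -
  assume x: "x \<in> \<Omega>"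
  have "\<forall>p\<in>fst c \<inter> f -` fst d. \<forall>u v. bil (gM c p) u v =
      bil (gN d (f p)) (chart_deriv c (snd d \<circ> f) p u) (chart_deriv c (snd d \<circ> f) p v)"
    using immersion c d unfolding isometric_immersion_def by blast
  from bspec[OF this in_\<Omega>(2)[OF x, unfolded chart_dom_def]] show ?thesis
    by (simp add: in_\<Omega>[OF x] chart_deriv_def)
qed

lemma unit_normal_local:
  assumes x: "x \<in> \<Omega>"
  shows "bil (loc_G (loc_F x)) (loc_\<xi> x) (loc_\<xi> x) = \<epsilon>"
    and "bil (loc_G (loc_F x)) (loc_\<xi> x) (\<partial> loc_F x u) = 0"
proof -
  have "\<forall>p\<in>fst c \<inter> f -` fst d. bil (gN d (f p)) (\<xi> d p) (\<xi> d p) = \<epsilon> \<and>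
      (\<forall>u. bil (gN d (f p)) (\<xi> d p) (chart_deriv c (snd d \<circ> f) p u) = 0)"
    using unit_normal c d unfolding unit_normal_field_def by blast
  from bspec[OF this in_\<Omega>(2)[OF x, unfolded chart_dom_def]]
  show "bil (loc_G (loc_F x)) (loc_\<xi> x) (loc_\<xi> x) = \<epsilon>"
    "bil (loc_G (loc_F x)) (loc_\<xi> x) (\<partial> loc_F x u) = 0"
    by (simp_all add: in_\<Omega>[OF x] chart_deriv_def)
qed

text \<open>The plane spanned by the normal and a tangent vector of a frame is nondegenerate, so that the
  curvature of the ambient space is known on all vectors.\<close>

lemma riem_normal_local:
  assumes x: "x \<in> \<Omega>"
  shows "bil (loc_G (loc_F x)) (riem loc_G (loc_F x) (\<partial> loc_F x u) (\<partial> loc_F x v) (loc_\<xi> x)) (\<partial> loc_F x z) = 0"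
proof -
  interpret N: metric_region "snd d ` fst d" loc_G
    by (rule metric_region_chart[OF pseudo_riemannian_N d])
  let ?p = "f (param c x)"
  obtain U \<sigma> e where U: "param c x \<in> U" "local_orthonormal_frame TM gM c U \<sigma> e"
    by (rule laplacian_terms[OF x])
  \<comment> \<open>The frame is nonempty, and any of its members will do.\<close>
  define E where "E = e undefined (param c x)"
  have "bil (loc_g x) E E = \<sigma> undefined" "\<sigma> undefined \<in> {1, -1}"
    using frame_at[OF U(2,1)] unfolding orthonormal_frame_def E_def by simp_all
  then have "bil (loc_g x) E E \<noteq> 0" by auto
  then have nd: "bil (loc_G (loc_F x)) (loc_\<xi> x) (loc_\<xi> x) * bil (loc_G (loc_F x)) (\<partial> loc_F x E) (\<partial> loc_F x E)
      - (bil (loc_G (loc_F x)) (loc_\<xi> x) (\<partial> loc_F x E))\<^sup>2 \<noteq> 0"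
    unfolding unit_normal_local[OF x] induced_metric[OF x, symmetric] using \<epsilon> by auto
  have sec: "bil (loc_G (loc_F x)) (riem loc_G (loc_F x) u v v) u =
      \<kappa> * (bil (loc_G (loc_F x)) u u * bil (loc_G (loc_F x)) v v - (bil (loc_G (loc_F x)) u v)\<^sup>2)"
    if "bil (loc_G (loc_F x)) u u * bil (loc_G (loc_F x)) v v - (bil (loc_G (loc_F x)) u v)\<^sup>2 \<noteq> 0" for u v
  proof -
    have K: "\<forall>u v. let Q = bil (gN d ?p) u u * bil (gN d ?p) v v - (bil (gN d ?p) u v)\<^sup>2
        in Q \<noteq> 0 \<longrightarrow> bil (gN d ?p) (curvature gN d ?p u v v) u / Q = \<kappa>"
      using ambient d in_\<Omega>(4)[OF x] unfolding space_form_def by blast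
    have GF: "loc_G (loc_F x) = gN d ?p" by (simp add: in_\<Omega>(5)[OF x])
    have R: "riem loc_G (loc_F x) u v v = curvature gN d ?p u v v"
      unfolding curvature_eq_riem[OF manifold_N d in_\<Omega>(4)[OF x]] o_apply ..
    show ?thesis
      using K[rule_format, of u v] that unfolding GF R Let_def by (simp add: divide_eq_eq)
  qed
  have tn: "bil (loc_G (loc_F x)) (\<partial> loc_F x u) (loc_\<xi> x) = 0" for u
    using N.sym[OF in_\<Omega>(6)[OF x], of "\<partial> loc_F x u"] unit_normal_local(2)[OF x] by metis
  have "bil (loc_G (loc_F x)) (riem loc_G (loc_F x) (\<partial> loc_F x u) (\<partial> loc_F x v) (loc_\<xi> x)) (\<partial> loc_F x z) =
      \<kappa> * (bil (loc_G (loc_F x)) (\<partial> loc_F x v) (loc_\<xi> x) * bil (loc_G (loc_F x)) (\<partial> loc_F x u) (\<partial> loc_F x z)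
        - bil (loc_G (loc_F x)) (\<partial> loc_F x u) (loc_\<xi> x) * bil (loc_G (loc_F x)) (\<partial> loc_F x v) (\<partial> loc_F x z))"
    by (rule N.riem_constant[OF in_\<Omega>(6)[OF x] sec nd])
  then show ?thesis unfolding tn by simp
qed

lemma patch: "hypersurface_patch (snd d ` fst d) loc_G \<Omega> loc_F loc_g loc_\<xi> loc_A \<epsilon>"
proof (intro hypersurface_patch.intro hypersurface_patch_axioms.intro map_region)
  interpret M: metric_region "snd c ` fst c" loc_g
    by (rule metric_region_chart[OF hypersurface c])
  have sub: "\<Omega> \<subseteq> snd c ` fst c" by (auto simp: chart_dom_def)
  show "smooth_on \<Omega> loc_g" by (rule smooth_on_subset[OF M.smooth_G sub])
  show "smooth_on \<Omega> loc_\<xi>"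
    using unit_normal c d unfolding unit_normal_field_def smooth_in_def chart_dom_def by blast
  fix x assume x: "x \<in> \<Omega>"
  show "bil (loc_g x) u v = bil (loc_G (loc_F x)) (\<partial> loc_F x u) (\<partial> loc_F x v)" for u v
    by (rule induced_metric[OF x])
  show "u = 0" if "\<And>v. bil (loc_g x) u v = 0" for u
    by (rule M.nondeg[OF _ that]) (use x sub in blast)
  show "cov loc_G loc_F loc_\<xi> x u = - \<partial> loc_F x (loc_A x *v u)" for u
  proof -
    have "cov_deriv gN c d f (\<xi> d) (param c x) u =
        - chart_deriv c (snd d \<circ> f) (param c x) (A c (param c x) *v u)"
      using shape c d in_\<Omega>(2)[OF x] unfolding shape_operator_def chart_dom_def by blast
    then show ?thesis
      using cov_deriv_eq_cov[of c "param c x" d f gN "\<xi> d" u] in_\<Omega>[OF x]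
      by (simp add: chart_deriv_def)
  qed
qed (use \<epsilon> unit_normal_local riem_normal_local in blast)+

text \<open>In the expression defining the Laplacian, both terms contain the first-order term in the direction of
  the derivative of the frame. It cancels, and the second covariant derivative at the point is left.\<close>

lemma local_mean_curvature_values:
  assumes "x \<in> \<Omega>"
  shows "loc_H x = 0 \<or> CARD('n) * (loc_H x)\<^sup>2 = \<epsilon> * lam" and "continuous_on \<Omega> loc_H"
proof -
  interpret P: hypersurface_patch "snd d ` fst d" loc_G \<Omega> loc_F loc_g loc_\<xi> loc_A \<epsilon>
    by (rule patch)
  have h: "loc_H q = \<epsilon> / CARD('n) * trace (loc_A q)" if "q \<in> \<Omega>" for q
    using mean_curvature[OF c in_\<Omega>(3)[OF that]] by simp
  have tr: "smooth_on \<Omega> (\<lambda>q. trace (loc_A q))"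
    by (rule smooth_on_linear[OF P.open_\<Omega> P.bounded_linear_trace P.smooth_shape])
  have sh: "smooth_on \<Omega> loc_H"
    by (rule smooth_on_cong[OF P.open_\<Omega> h[symmetric] smooth_on_mult[OF P.open_\<Omega> smooth_on_const tr]])
  let ?V = "\<lambda>q. loc_H q *\<^sub>R loc_\<xi> q"
  have sV: "smooth_on \<Omega> ?V" by (rule smooth_on_scaleR[OF P.open_\<Omega> sh P.smooth_\<xi>])
  have cov_V: "cov_deriv gN c d f (\<lambda>q. H q *\<^sub>R \<xi> d q) (param c x) u = cov loc_G loc_F ?V x u"
    if "x \<in> \<Omega>" for x u
    using cov_deriv_eq_cov[of c "param c x" d f gN "\<lambda>q. H q *\<^sub>R \<xi> d q" u] in_\<Omega>[OF that]
    by (simp add: comp_def)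
  have lap: "\<exists>\<sigma> e. orthonormal_frame (loc_g x) \<sigma> e \<and>
      (\<Sum>i\<in>UNIV. \<sigma> i *\<^sub>R P.hess ?V x (e i) (e i)) = (- lam * loc_H x) *\<^sub>R loc_\<xi> x"
    if x: "x \<in> \<Omega>" for x
  proof -
    obtain U \<sigma> e where U: "param c x \<in> U" and frame: "local_orthonormal_frame TM gM c U \<sigma> e" and
      eq: "(\<Sum>i\<in>UNIV. \<sigma> i *\<^sub>R
        (cov_deriv gN c d f (\<lambda>q. cov_deriv gN c d f (\<lambda>q. H q *\<^sub>R \<xi> d q) q (e i q)) (param c x) (e i (param c x))
         - cov_deriv gN c d f (\<lambda>q. H q *\<^sub>R \<xi> d q) (param c x)
             (cov_deriv gM c c id (e i) (param c x) (e i (param c x))))) =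
      (- lam * loc_H x) *\<^sub>R loc_\<xi> x"
      by (rule laplacian_terms[OF x])
    define \<Omega>' where "\<Omega>' = snd c ` (U \<inter> chart_dom c d)"
    have UT: "openin TM U" "U \<subseteq> fst c" and se: "\<And>i. smooth_on (snd c ` U) (e i \<circ> param c)"
      using frame unfolding local_orthonormal_frame_def smooth_in_def by blast+
    have \<Omega>': "open \<Omega>'" "\<Omega>' \<subseteq> \<Omega>"
      unfolding \<Omega>'_def using UT
      by (auto intro!: open_chart_image[OF manifold_M c] openin_Int openin_chart_dom[OF c d])
    have x': "x \<in> \<Omega>'"
      unfolding \<Omega>'_def using in_\<Omega>(1,2)[OF x] U by (metis IntI image_eqI)
    have "cov_deriv gN c d f (\<lambda>q. cov_deriv gN c d f (\<lambda>q. H q *\<^sub>R \<xi> d q) q (e i q)) (param c x) (e i (param c x))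
         - cov_deriv gN c d f (\<lambda>q. H q *\<^sub>R \<xi> d q) (param c x)
             (cov_deriv gM c c id (e i) (param c x) (e i (param c x)))
        = P.hess ?V x (e i (param c x)) (e i (param c x))" for i
    proof -
      let ?E = "e i \<circ> param c"
      have sE: "smooth_on \<Omega>' ?E"
        by (rule smooth_on_subset[OF se]) (auto simp: \<Omega>'_def)
      have "cov_deriv gN c d f (\<lambda>q. cov_deriv gN c d f (\<lambda>q. H q *\<^sub>R \<xi> d q) q (e i q)) (param c x) (?E x)
          = cov loc_G loc_F ((\<lambda>q. cov_deriv gN c d f (\<lambda>q. H q *\<^sub>R \<xi> d q) q (e i q)) \<circ> param c) x (?E x)"
        using cov_deriv_eq_cov[of c "param c x" d f gN] in_\<Omega>[OF x] by simp
      also have "\<dots> = cov loc_G loc_F (\<lambda>q. cov loc_G loc_F ?V q (?E q)) x (?E x)"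
        by (rule cov_cong_open[OF P.open_\<Omega> x]) (simp only: o_apply cov_V)
      also have "\<dots> = cov loc_G loc_F (\<lambda>q. cov loc_G loc_F ?V q (?E x)) x (?E x)
          + cov loc_G loc_F ?V x (\<partial> ?E x (?E x))"
        by (rule P.cov_cov_field[OF sV sE \<Omega>' x'])
      finally have 1: "cov_deriv gN c d f (\<lambda>q. cov_deriv gN c d f (\<lambda>q. H q *\<^sub>R \<xi> d q) q (e i q)) (param c x) (?E x)
          = \<dots>" .
      have "cov_deriv gM c c id (e i) (param c x) (?E x) = cov loc_g id ?E x (?E x)"
        using cov_deriv_eq_cov_id[OF manifold_M c in_\<Omega>(3)[OF x]] in_\<Omega>(1)[OF x] by simp
      also have "\<dots> = \<partial> ?E x (?E x) + Christoffel loc_g x (?E x) (?E x)"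
        by (simp add: cov_def)
      finally have 2: "cov_deriv gN c d f (\<lambda>q. H q *\<^sub>R \<xi> d q) (param c x)
             (cov_deriv gM c c id (e i) (param c x) (?E x)) =
          cov loc_G loc_F ?V x (\<partial> ?E x (?E x)) + cov loc_G loc_F ?V x (Christoffel loc_g x (?E x) (?E x))"
        by (simp only: cov_V[OF x] linear_add[OF P.linear_cov[OF sV x]])
      show ?thesis using 1 2 by (simp add: P.hess_def)
    qed
    then have "(\<Sum>i\<in>UNIV. \<sigma> i *\<^sub>R P.hess ?V x (e i (param c x)) (e i (param c x)))
        = (- lam * loc_H x) *\<^sub>R loc_\<xi> x"
      using eq by simp
    with frame_at[OF frame U] show ?thesis by blast
  qed
  have single: "\<exists>!\<mu>. principal_curvature (loc_A q) \<mu>" if "q \<in> \<Omega>" for q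
    using one_principal_curvature[OF c in_\<Omega>(3)[OF that]] by simp
  show "loc_H x = 0 \<or> CARD('n) * (loc_H x)\<^sup>2 = \<epsilon> * lam"
    by (rule P.mean_curvature_dichotomy(1)[OF h lap single assms])
  show "continuous_on \<Omega> loc_H"
    by (rule P.mean_curvature_dichotomy(2)[OF h lap single assms])
qed

end

lemma charts_around:
  assumes "p \<in> topspace TM"
  obtains c d where "c \<in> AM" "d \<in> AN" "p \<in> chart_dom c d"
proof -
  have "continuous_map TM TN f" using immersion by (simp add: isometric_immersion_def)
  then have "f p \<in> topspace TN" using assms by (auto simp: continuous_map_def)
  then obtain d where "d \<in> AN" "f p \<in> fst d"
    using manifold_N unfolding smooth_manifold_def by blast
  moreover obtain c where "c \<in> AM" "p \<in> fst c"
    using assms manifold_M unfolding smooth_manifold_def by blast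
  ultimately show ?thesis by (intro that[of c d]) (auto simp: chart_dom_def)
qed

lemma mean_curvature_values:
  assumes "p \<in> topspace TM"
  shows "H p = 0 \<or> CARD('n) * (H p)\<^sup>2 = \<epsilon> * lam"
proof -
  obtain c d where cd: "c \<in> AM" "d \<in> AN" "p \<in> chart_dom c d" using charts_around[OF assms] .
  have "param c (snd c p) = p"
    by (rule param_chart[OF manifold_M cd(1)]) (use cd(3) in \<open>simp add: chart_dom_def\<close>)
  then show ?thesis using local_mean_curvature_values(1)[OF cd(1,2), of "snd c p"] cd(3) by simp
qed

lemma continuous_H: "continuous_map TM euclideanreal H"
proof (rule pasting_lemma[where T = "\<lambda>(c, d). chart_dom c d" and I = "AM \<times> AN" and f = "\<lambda>_. H"])
  fix i assume "i \<in> AM \<times> AN"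
  then obtain c d where i: "i = (c, d)" and c: "c \<in> AM" and d: "d \<in> AN" by auto
  show "openin TM (case i of (c, d) \<Rightarrow> chart_dom c d)" using openin_chart_dom[OF c d] by (simp add: i)
  have sub: "chart_dom c d \<subseteq> fst c" by (auto simp: chart_dom_def)
  have top: "topspace (subtopology TM (chart_dom c d)) = chart_dom c d"
    using openin_subset[OF openin_chart_dom[OF c d]] by auto
  have "continuous_map (subtopology TM (chart_dom c d)) (top_of_set (snd c ` fst c)) (snd c)"
    using continuous_map_from_subtopology_mono[OF homeomorphic_imp_continuous_map[OF chart_homeo[OF manifold_M c]] sub] .
  then have 1: "continuous_map (subtopology TM (chart_dom c d)) (top_of_set (snd c ` chart_dom c d)) (snd c)"
    by (simp add: continuous_map_in_subtopology top)
  have "continuous_on (snd c ` chart_dom c d) (H \<circ> param c)"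
  proof (cases "chart_dom c d = {}")
    case False
    then show ?thesis using local_mean_curvature_values(2)[OF c d] by blast
  qed simp
  then have "continuous_map (top_of_set (snd c ` chart_dom c d)) euclideanreal (H \<circ> param c)"
    by simp
  from continuous_map_compose[OF 1 this]
  show "continuous_map (subtopology TM (case i of (c, d) \<Rightarrow> chart_dom c d)) euclideanreal H"
    unfolding i prod.case
    by (rule continuous_map_eq) (use sub param_chart[OF manifold_M c] top in auto)
next
  fix p assume "p \<in> topspace TM"
  then obtain c d where "c \<in> AM" "d \<in> AN" "p \<in> chart_dom c d" by (rule charts_around)
  then show "\<exists>j. j \<in> AM \<times> AN \<and> p \<in> (case j of (c, d) \<Rightarrow> chart_dom c d) \<and> H p = H p"
    by (intro exI[of _ "(c, d)"]) simp
qed simp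

text \<open>The squared mean curvature is continuous with at most two values, hence constant on components.\<close>

lemma mean_curvature_on_components:
  shows "\<epsilon> * lam \<le> 0 \<Longrightarrow> p \<in> topspace TM \<Longrightarrow> H p = 0"
    and "C \<in> connected_components_of TM \<Longrightarrow>
      (\<forall>p\<in>C. H p = 0) \<or> (\<forall>p\<in>C. (H p)\<^sup>2 = \<epsilon> * lam / CARD('n))"
proof -
  have pt: "(H p)\<^sup>2 = 0 \<or> (H p)\<^sup>2 = \<epsilon> * lam / CARD('n)" if "p \<in> topspace TM" for p
    using mean_curvature_values[OF that] by (auto simp: field_simps)
  show "H p = 0" if "\<epsilon> * lam \<le> 0" "p \<in> topspace TM"
  proof -
    have "\<epsilon> * lam / CARD('n) \<le> 0" using that(1) by (simp add: divide_nonpos_nonneg)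
    then have "(H p)\<^sup>2 \<le> 0" using pt[OF that(2)] by linarith
    then show ?thesis by simp
  qed
  assume C: "C \<in> connected_components_of TM"
  let ?S = "(\<lambda>p. (H p)\<^sup>2) ` C"
  have "continuous_map TM euclideanreal (\<lambda>p. (H p)\<^sup>2)"
    by (rule continuous_map_real_pow[OF continuous_H])
  then have "connected ?S"
    using connectedin_continuous_map_image connectedin_connected_components_of[OF C] by fastforce
  moreover have "?S \<subseteq> {0, \<epsilon> * lam / CARD('n)}"
    using pt connected_components_of_subset[OF C] by blast
  then have "finite ?S" by (rule finite_subset) simp
  ultimately obtain a where "?S \<subseteq> {a}" using connected_finite_iff_sing[of ?S] by blast
  then have a: "(H p)\<^sup>2 = a" if "p \<in> C" for p using that by blast
  show "(\<forall>p\<in>C. H p = 0) \<or> (\<forall>p\<in>C. (H p)\<^sup>2 = \<epsilon> * lam / CARD('n))"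
  proof (cases "a = 0")
    case True
    then show ?thesis using a by simp
  next
    case False
    then show ?thesis using a pt connected_components_of_subset[OF C] by (metis subsetD)
  qed
qed

end

theorem theorem4p1:
  fixes TM :: "'m topology" and AM :: "('m, 4) chart set" and gM :: "('m, 4) metric" and r :: nat
    and TN :: "'q topology" and AN :: "('q, 5) chart set" and gN :: "('q, 5) metric" and s :: nat
    and \<kappa> lam \<epsilon> :: real
    and f :: "'m \<Rightarrow> 'q"
    and \<xi> :: "('q, 5) chart \<Rightarrow> 'm \<Rightarrow> real^5"
    and A :: "('m, 4) chart \<Rightarrow> 'm \<Rightarrow> real^4^4"
    and H :: "'m \<Rightarrow> real"
  assumes ambient: "space_form TN AN gN s \<kappa>"
    and hypersurface: "pseudo_riemannian TM AM gM r"
      "isometric_immersion TM AM gM TN AN gN f"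
    and normal: "\<epsilon> = 1 \<or> \<epsilon> = -1" "unit_normal_field AM AN gN f \<xi> \<epsilon>"
    and shape: "shape_operator AM AN gN f \<xi> A"
    and mean_curvature: "\<And>c p. c \<in> AM \<Longrightarrow> p \<in> fst c \<Longrightarrow> H p = 1/4 * \<epsilon> * trace (A c p)"
    and proper: "\<And>c d p. c \<in> AM \<Longrightarrow> d \<in> AN \<Longrightarrow> p \<in> fst c \<Longrightarrow> f p \<in> fst d \<Longrightarrow>
      is_laplacian_along TM gM gN f c d (\<lambda>q. H q *\<^sub>R \<xi> d q) p (lam *\<^sub>R (H p *\<^sub>R \<xi> d p))"
    and one_principal_curvature: "\<And>c p. c \<in> AM \<Longrightarrow> p \<in> fst c \<Longrightarrow>
      \<exists>!\<mu>. principal_curvature (A c p) \<mu>"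
  shows "(\<epsilon> * lam \<le> 0 \<longrightarrow> (\<forall>p\<in>topspace TM. H p = 0)) \<and>
    (\<epsilon> * lam > 0 \<longrightarrow> (\<forall>C\<in>connected_components_of TM.
        (\<forall>p\<in>C. H p = 0) \<or> (\<forall>p\<in>C. (H p)\<^sup>2 = \<epsilon> * lam / 4)))"
proof -
  interpret proper_hypersurface TM AM gM r TN AN gN s \<kappa> lam \<epsilon> f \<xi> A H
    using assms by unfold_locales simp_all
  show ?thesis using mean_curvature_on_components by simp
qed

end
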